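(* Let $\mathbf{x}=(x_1,\dots,x_k)$ be a fixed vector of positive integers, let $r=\sum_{i=1}^k x_i$, and suppose that $x_1\geq\dots\geq x_t>x_{t+1}=\dots=x_k=1$ for some $1\le t<k$. Then \[ m(\mathbf{x},n)\leq(1+o(1))\frac{\binom{n-t}{r-k}}{\binom{r-t}{r-k}}=\left(\frac{(k-t)!}{(r-t)!}+o(1)\right)n^{r-k}, \] where $o(1)$ denotes a quantity tending to $0$ as $n\to\infty$ with $\mathbf{x}$ fixed.
   Context: $[n]=\{1,\dots,n\}$ and $[n]^{(r)}$ is the family of all $r$-element subsets of $[n]$. A Hamilton cycle in $K_n$ (on vertex set $[n]$) is regarded as a cyclic ordering $c_1,c_2,\dots,c_n$ of $[n]$, with indices taken modulo $n$. For $\mathbf{x}=(x_1,\dots,x_k)$ a vector of positive integers with $\sum_i x_i=r$ and a family $\mathcal{F}\subseteq[n]^{(r)}$, a Hamilton cycle $c_1,\dots,c_n$ is called $\mathbf{x}$-acceptable for (or with respect to) $\mathcal{F}$ if there do not exist $t_1,\dots,t_k$ with $\bigcup_{i=1}^k\{c_{t_i+1},c_{t_i+2},\dots,c_{t_i+x_i}\}\in\mathcal{F}$. Then $m(\mathbf{x},n)$ (for $n\ge r$) denotes the minimum of $|\mathcal{F}|$ over all families $\mathcal{F}\subseteq[n]^{(r)}$ such that $K_n$ does not contain an $\mathbf{x}$-acceptable Hamilton cycle with respect to $\mathcal{F}$. *)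

theory Defs
  imports Complex_Main "HOL-Library.Ramsey"
begin

text \<open>
  A cyclic ordering of \<open>{1..n}\<close> is a bijection from the residues \<open>{..<n}\<close> onto \<open>{1..n}\<close>;
  \<open>c\<close> is only ever read at arguments reduced modulo \<open>n\<close> (position \<open>0\<close> is the paper's \<open>c\<^sub>n\<close>).
  Rotations and reflections of the same cycle are not identified, which is harmless
  because only existence of a cycle is ever asserted.
\<close>
definition hamilton_cycle :: "nat \<Rightarrow> (nat \<Rightarrow> nat) \<Rightarrow> bool" where
  "hamilton_cycle n c \<longleftrightarrow> bij_betw c {..<n} {1..n}"

definition arc :: "nat \<Rightarrow> (nat \<Rightarrow> nat) \<Rightarrow> nat \<Rightarrow> nat \<Rightarrow> nat set" where
  "arc n c s l = (\<lambda>j. c ((s + j) mod n)) ` {1..l}"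

text \<open>The arcs in the union are allowed to overlap.\<close>
definition acceptable :: "nat list \<Rightarrow> nat \<Rightarrow> nat set set \<Rightarrow> (nat \<Rightarrow> nat) \<Rightarrow> bool" where
  "acceptable x n F c \<longleftrightarrow>
     \<not> (\<exists>s :: nat \<Rightarrow> nat. (\<Union>i<length x. arc n c (s i) (x ! i)) \<in> F)"

text \<open>
  The families below form a finite set, nonempty when \<open>n \<ge> sum_list x\<close>
  (it contains the family of all \<open>r\<close>-sets); for smaller \<open>n\<close> the value is irrelevant.
\<close>
definition m :: "nat list \<Rightarrow> nat \<Rightarrow> nat" where
  "m x n = Min (card ` {F. F \<subseteq> nsets {1..n} (sum_list x) \<and>
                           \<not> (\<exists>c. hamilton_cycle n c \<and> acceptable x n F c)})"

end

theory Submission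
  imports Defs "HOL-Combinatorics.Permutations" "HOL-Computational_Algebra.Polynomial"
    "HOL-Real_Asymp.Real_Asymp"
begin

text \<open>
  Let \<open>s = r - k\<close> and \<open>q = r - t\<close>. The family consists of the sets \<open>{1..t} \<union> B\<close>, where \<open>B\<close> runs
  through a covering design on \<open>{t + 1..n}\<close>: a collection of \<open>q\<close>-sets such that each \<open>s\<close>-set lies in
  one of them. In a long cycle, disjoint arcs of lengths \<open>x\<^sub>1, ..., x\<^sub>t\<close> can be placed so that they
  contain the vertices \<open>1, ..., t\<close>. They contain exactly \<open>s\<close> other vertices, which lie in a block
  \<open>B\<close>, and the \<open>k - t\<close> arcs of length \<open>1\<close> can be chosen to be the rest of \<open>B\<close> (\<open>m_le_covering\<close>).
  So it remains to find covering designs with \<open>(1 + o(1)) * (n choose s) / (q choose s)\<close> blocks on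
  \<open>n\<close> points (\<open>asymptotic_covering\<close>), and for this it suffices to find packings, that is,
  collections of \<open>q\<close>-sets that pairwise share fewer than \<open>s\<close> points, which leave only a vanishing
  proportion of the \<open>s\<close>-sets uncovered.

  This is Rodl's theorem. The proof below does not iterate a random nibble. It combines an algebraic
  product with a single random step and a limit argument. Let \<open>K\<close> be a constant and let all
  positive integers below \<open>K\<close> be coprime to \<open>M\<close>. The graphs on \<open>{..<K}\<close> of the polynomials of
  degree less than \<open>s\<close> modulo \<open>M\<close> are \<open>K\<close>-sets in \<open>{..<K} \<times> {..<M}\<close>, and each \<open>s\<close>-set with points
  in different columns lies on exactly one of them. Filling each graph with a copy of an optimal
  packing of \<open>K\<close> points gives a packing of \<open>K * M\<close> points of the same density. If the copies are
  permuted independently at random, then a \<open>q\<close>-set in general position has all its \<open>s\<close>-subsets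
  uncovered with probability \<open>w ^ (q choose s)\<close>, where \<open>w\<close> is the uncovered proportion in the packing
  of \<open>K\<close> points. So for some choice of the permutations there are many such \<open>q\<close>-sets, and the greedy
  algorithm adds a positive proportion of blocks if \<open>w\<close> is bounded away from \<open>0\<close> (\<open>pack_product\<close>).

  The product alone shows that the density of optimal packings converges to its supremum; the
  additional blocks show that this supremum can only be \<open>1\<close> (\<open>density_tendsto_1\<close>).
\<close>

section \<open>Polynomials over residue rings\<close>

text \<open>
  A polynomial of degree less than \<open>card I\<close> with roots modulo \<open>M\<close> at all points of \<open>I\<close> vanishes
  modulo \<open>M\<close>, even for composite \<open>M\<close>, as long as the differences of these points are units.
\<close>
lemma poly_roots_mod:
  fixes p :: "int poly" and M :: int
  assumes "finite I" "degree p < card I" "\<And>i. i \<in> I \<Longrightarrow> M dvd poly p i"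
    and "\<And>i j. i \<in> I \<Longrightarrow> j \<in> I \<Longrightarrow> i \<noteq> j \<Longrightarrow> coprime (i - j) M"
  shows "[:M:] dvd p"
  using assms
proof (induction "card I" arbitrary: I p)
  case 0
  then show ?case by simp
next
  case (Suc m)
  obtain a where a: "a \<in> I" using Suc.hyps(2) by fastforce
  define g where "g = synthetic_div p a"
  have p: "p = [:- a, 1:] * g + [:poly p a:]"
    unfolding g_def by (rule synthetic_div_correct'[symmetric])
  have "[:M:] dvd g"
  proof (cases "degree p = 0")
    case True
    then have "g = 0" unfolding g_def using synthetic_div_eq_0_iff[of p a] by simp
    then show ?thesis by simp
  next
    case False
    have card: "m = card (I - {a})" using Suc.hyps(2) a Suc.prems(1) by simp
    show ?thesis
    proof (rule Suc.hyps(1)[OF card])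
      show "degree g < card (I - {a})"
        using False Suc.prems(2) Suc.hyps(2) card unfolding g_def degree_synthetic_div by linarith
      show "M dvd poly g i" if "i \<in> I - {a}" for i
      proof -
        have "M dvd poly p i" "M dvd poly p a" using Suc.prems(3) that a by auto
        moreover have "poly p i = (i - a) * poly g i + poly p a"
          by (subst p) (simp add: algebra_simps)
        ultimately have "M dvd (i - a) * poly g i" by (simp add: dvd_add_left_iff)
        moreover have "coprime (i - a) M" using Suc.prems(4) that a by auto
        ultimately show ?thesis
          by (metis coprime_commute coprime_dvd_mult_right_iff)
      qed
    qed (use Suc.prems in auto)
  qed
  moreover have "[:M:] dvd [:poly p a:]" using Suc.prems(3) a by simp
  ultimately show ?case by (subst p) (intro dvd_add dvd_mult)
qed

text \<open>
  The setting of the transversal design: polynomials of degree less than \<open>s\<close> over the residues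
  modulo \<open>M\<close>, evaluated at the points \<open>i < K\<close>. All nonzero differences of evaluation points are
  units, so a polynomial is determined by its values at any \<open>s\<close> of these points, and all value
  tuples occur.
\<close>
locale polynomial_code =
  fixes M K s :: nat
  assumes s_pos: "0 < s" and M_pos: "0 < M"
    and coprime_M: "\<And>d. 0 < d \<Longrightarrow> d < K \<Longrightarrow> coprime d M"
begin

text \<open>
  A polynomial is represented by its coefficient function on \<open>{..<s}\<close>; \<open>ev f i\<close> is its value at
  \<open>i\<close>, reduced modulo \<open>M\<close>.
\<close>
definition polys :: "(nat \<Rightarrow> nat) set" where
  "polys = ({..<s} \<rightarrow>\<^sub>E {..<M})"

definition ev :: "(nat \<Rightarrow> nat) \<Rightarrow> nat \<Rightarrow> nat" where
  "ev f i = (\<Sum>j<s. f j * i ^ j) mod M"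

lemma finite_polys: "finite polys"
  unfolding polys_def by (intro finite_PiE) auto

lemma card_polys: "card polys = M ^ s"
  unfolding polys_def by (simp add: card_PiE)

lemma ev_less: "ev f i < M"
  using M_pos by (simp add: ev_def)

lemma agree_unique:
  assumes f: "f \<in> polys" and f': "f' \<in> polys" and I: "I \<subseteq> {..<K}" "s \<le> card I"
    and eq: "\<And>i. i \<in> I \<Longrightarrow> ev f i = ev f' i"
  shows "f = f'"
proof -
  define p :: "int poly" where "p = (\<Sum>j<s. monom (int (f j) - int (f' j)) j)"
  have coeff: "coeff p j = int (f j) - int (f' j)" if "j < s" for j
    using that unfolding p_def by (simp add: coeff_sum)
  have finI: "finite I" using I finite_subset by blast
  have poly: "poly p (int i) = (\<Sum>j<s. int (f j) * int i ^ j) - (\<Sum>j<s. int (f' j) * int i ^ j)" for i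
    unfolding p_def by (simp add: poly_sum poly_monom sum_subtractf left_diff_distrib)
  have "[:int M:] dvd p"
  proof (rule poly_roots_mod)
    show "finite (int ` I)" using finI by simp
    have "degree p < s"
      unfolding p_def by (rule degree_sum_less) (use s_pos degree_monom_le le_less_trans in blast)+
    then show "degree p < card (int ` I)" using I(2) by (simp add: card_image)
  next
    fix i assume "i \<in> int ` I"
    then obtain n where n: "n \<in> I" "i = int n" by auto
    have "int ((\<Sum>j<s. f j * n ^ j) mod M) = int ((\<Sum>j<s. f' j * n ^ j) mod M)"
      using eq[OF n(1)] by (simp add: ev_def)
    then have "(\<Sum>j<s. int (f j) * int n ^ j) mod int M = (\<Sum>j<s. int (f' j) * int n ^ j) mod int M"
      by (simp add: zmod_int)
    then show "int M dvd poly p i"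
      unfolding n(2) poly by (simp add: mod_eq_dvd_iff)
  next
    fix i j assume "i \<in> int ` I" "j \<in> int ` I" "i \<noteq> j"
    then obtain a b where ab: "a < K" "b < K" "i = int a" "j = int b" "a \<noteq> b" using I(1) by auto
    show "coprime (i - j) (int M)"
    proof (cases "a < b")
      case True
      then have "coprime (int (b - a)) (int M)"
        using coprime_M[of "b - a"] ab by (simp add: coprime_int_iff del: of_nat_diff)
      moreover have "i - j = - int (b - a)" using True ab by simp
      ultimately show ?thesis by simp
    next
      case False
      then have "coprime (int (a - b)) (int M)"
        using coprime_M[of "a - b"] ab by (simp add: coprime_int_iff del: of_nat_diff)
      moreover have "i - j = int (a - b)" using False ab by simp
      ultimately show ?thesis by simp
    qed
  qed
  then have dvd: "int M dvd coeff p j" for j by (simp add: const_poly_dvd_iff)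
  have "f j = f' j" if "j < s" for j
  proof -
    have "int (f j) mod int M = int (f' j) mod int M"
      using dvd[of j] coeff[OF that] by (simp add: mod_eq_dvd_iff)
    moreover have "f j < M" "f' j < M" using f f' that unfolding polys_def by auto
    ultimately show ?thesis by simp
  qed
  then show ?thesis using f f' unfolding polys_def by (intro PiE_ext) auto
qed

text \<open>
  Existence follows from uniqueness, since there are as many polynomials as value tuples on \<open>I\<close>.
\<close>
lemma interpolation:
  assumes I: "I \<subseteq> {..<K}" "card I = s" and g: "g \<in> I \<rightarrow> {..<M}"
  shows "\<exists>f\<in>polys. \<forall>i\<in>I. ev f i = g i"
proof -
  have finI: "finite I" using I finite_subset by blast
  let ?r = "\<lambda>f. restrict (ev f) I"
  have inj: "inj_on ?r polys"
  proof (rule inj_onI)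
    fix f f' assume "f \<in> polys" "f' \<in> polys" "?r f = ?r f'"
    then show "f = f'"
      using I by (intro agree_unique[of f f' I]) (auto simp: restrict_def fun_eq_iff split: if_splits)
  qed
  have sub: "?r ` polys \<subseteq> (I \<rightarrow>\<^sub>E {..<M})" using ev_less by auto
  have "?r ` polys = (I \<rightarrow>\<^sub>E {..<M})"
  proof (rule card_subset_eq[OF _ sub])
    show "finite (I \<rightarrow>\<^sub>E {..<M})" using finI by (intro finite_PiE) auto
    show "card (?r ` polys) = card (I \<rightarrow>\<^sub>E {..<M})"
      using finI I by (simp add: card_image[OF inj] card_polys card_PiE)
  qed
  moreover have "restrict g I \<in> (I \<rightarrow>\<^sub>E {..<M})" using g by auto
  ultimately obtain f where "f \<in> polys" "restrict g I = ?r f" by blast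
  then show ?thesis by (metis restrict_apply')
qed

text \<open>
  The polynomial through the values of \<open>g\<close> on \<open>I\<close>; meaningful only for \<open>card I = s\<close>.
\<close>
definition interp :: "(nat \<Rightarrow> nat) \<Rightarrow> nat set \<Rightarrow> (nat \<Rightarrow> nat)" where
  "interp g I = (SOME f. f \<in> polys \<and> (\<forall>i\<in>I. ev f i = g i))"

lemma interp:
  assumes "I \<subseteq> {..<K}" "card I = s" "g \<in> I \<rightarrow> {..<M}"
  shows "interp g I \<in> polys" "\<And>i. i \<in> I \<Longrightarrow> ev (interp g I) i = g i"
proof -
  have "\<exists>f. f \<in> polys \<and> (\<forall>i\<in>I. ev f i = g i)" using interpolation[OF assms] by blast
  from someI_ex[OF this]
  show "interp g I \<in> polys" "\<And>i. i \<in> I \<Longrightarrow> ev (interp g I) i = g i"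
    unfolding interp_def by auto
qed

lemma interp_eqI:
  assumes "I \<subseteq> {..<K}" "card I = s" "g \<in> I \<rightarrow> {..<M}" "f \<in> polys" "\<And>i. i \<in> I \<Longrightarrow> ev f i = g i"
  shows "interp g I = f"
  by (rule agree_unique[of _ _ I]) (use assms interp[OF assms(1-3)] in auto)

end

section \<open>Packings\<close>

text \<open>
  A packing: blocks of size \<open>q\<close> in \<open>V\<close> such that no \<open>s\<close>-set lies in two of them. The largest
  number of blocks depends on \<open>card V\<close> only and is denoted \<open>pack s q (card V)\<close>.
\<close>
definition packing :: "nat \<Rightarrow> nat \<Rightarrow> 'a set \<Rightarrow> 'a set set \<Rightarrow> bool" where
  "packing s q V P \<longleftrightarrow> P \<subseteq> nsets V q \<and> (\<forall>A\<in>P. \<forall>B\<in>P. A \<noteq> B \<longrightarrow> card (A \<inter> B) < s)"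

definition pack :: "nat \<Rightarrow> nat \<Rightarrow> nat \<Rightarrow> nat" where
  "pack s q n = Max (card ` {P. packing s q {..<n} P})"

lemma finite_packings: "finite V \<Longrightarrow> finite {P. packing s q V P}"
  by (rule finite_subset[of _ "Pow (nsets V q)"]) (auto simp: packing_def finite_imp_finite_nsets)

lemma packing_finite: "finite V \<Longrightarrow> packing s q V P \<Longrightarrow> finite P"
  unfolding packing_def using finite_imp_finite_nsets finite_subset by blast

lemma packing_empty: "packing s q V {}"
  by (simp add: packing_def)

lemma pack_attained:
  obtains P where "packing s q {..<n} P" "card P = pack s q n"
proof -
  have "pack s q n \<in> card ` {P. packing s q {..<n} P}"
    unfolding pack_def using finite_packings[of "{..<n}" s q] packing_empty[of s q "{..<n}"]
    by (intro Max_in) auto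
  then show ?thesis using that by auto
qed

lemma packing_mono: "packing s q V P \<Longrightarrow> V \<subseteq> V' \<Longrightarrow> packing s q V' P"
  unfolding packing_def by (metis nsets_mono subset_trans)

lemma packing_Un:
  assumes P: "packing s q V P" and X: "packing s q V X"
    and disj: "\<And>A B. A \<in> X \<Longrightarrow> B \<in> P \<Longrightarrow> card (A \<inter> B) < s"
  shows "packing s q V (P \<union> X)"
proof -
  have "card (A \<inter> B) < s" if AB: "A \<in> P \<union> X" "B \<in> P \<union> X" "A \<noteq> B" for A B
  proof (cases "A \<in> P"; cases "B \<in> P")
    assume "A \<in> P" "B \<notin> P"
    then show ?thesis using AB disj[of B A] by (simp add: Int_commute)
  qed (use AB P X disj in \<open>auto simp: packing_def\<close>)
  then show ?thesis using P X by (simp add: packing_def)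
qed

lemma packing_image:
  assumes "packing s q V P" "inj_on u V"
  shows "packing s q (u ` V) ((`) u ` P)" "card ((`) u ` P) = card P"
proof -
  have sub: "A \<subseteq> V" if "A \<in> P" for A using that assms(1) by (auto simp: packing_def nsets_def)
  have inj: "inj_on u A" if "A \<in> P" for A using sub[OF that] assms(2) inj_on_subset by blast
  show "packing s q (u ` V) ((`) u ` P)"
    unfolding packing_def
  proof (intro conjI ballI impI)
    show "(`) u ` P \<subseteq> nsets (u ` V) q"
    proof
      fix A' assume "A' \<in> (`) u ` P"
      then obtain A where A: "A \<in> P" "A' = u ` A" by blast
      then have "A \<in> nsets V q" using assms(1) by (auto simp: packing_def)
      then show "A' \<in> nsets (u ` V) q"
        using inj[OF A(1)] unfolding A(2) nsets_def by (auto simp: card_image)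
    qed
    fix A' B' assume "A' \<in> (`) u ` P" "B' \<in> (`) u ` P" "A' \<noteq> B'"
    then obtain A B where AB: "A \<in> P" "B \<in> P" "A' = u ` A" "B' = u ` B" "A \<noteq> B" by blast
    have "A' \<inter> B' = u ` (A \<inter> B)"
      unfolding AB using inj_on_image_Int[OF assms(2) sub[OF AB(1)] sub[OF AB(2)]] by simp
    also have "card \<dots> \<le> card (A \<inter> B)"
      by (intro card_image_le) (use AB assms(1) in \<open>auto simp: packing_def nsets_def\<close>)
    finally show "card (A' \<inter> B') < s" using AB assms(1) unfolding packing_def by fastforce
  qed
  have "inj_on ((`) u) P"
    using inj_on_image_eq_iff[OF assms(2) sub sub] by (intro inj_onI) blast
  then show "card ((`) u ` P) = card P" by (rule card_image)
qed

lemma card_packing_le_pack: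
  assumes "finite V" "packing s q V P" "card V \<le> n"
  shows "card P \<le> pack s q n"
proof -
  obtain u where u: "inj_on u V" "u ` V \<subseteq> {..<n}"
    using card_le_inj[of V "{..<n}"] assms by auto
  have "packing s q {..<n} ((`) u ` P)"
    by (rule packing_mono[OF packing_image(1)[OF assms(2) u(1)] u(2)])
  then have "card ((`) u ` P) \<le> pack s q n"
    unfolding pack_def using finite_packings[of "{..<n}" s q] by (intro Max_ge) auto
  then show ?thesis using packing_image(2)[OF assms(2) u(1)] by simp
qed

lemma packing_on_attained:
  assumes "finite V"
  obtains P where "packing s q V P" "card P = pack s q (card V)"
proof -
  obtain P where P: "packing s q {..<card V} P" "card P = pack s q (card V)" by (rule pack_attained)
  obtain u where u: "bij_betw u {..<card V} V"
    using ex_bij_betw_nat_finite[OF assms] atLeast0LessThan by metis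
  show ?thesis
    using packing_image[OF P(1), of u] u P(2) by (intro that[of "(`) u ` P"]) (auto simp: bij_betw_def)
qed

text \<open>
  The \<open>s\<close>-sets that lie in no block of \<open>P\<close>.
\<close>
definition uncovered :: "nat \<Rightarrow> 'a set \<Rightarrow> 'a set set \<Rightarrow> 'a set set" where
  "uncovered s V P = {S \<in> nsets V s. \<forall>B\<in>P. \<not> S \<subseteq> B}"

lemma packing_count:
  assumes "finite V" "packing s q V P"
  shows "(q choose s) * card P + card (uncovered s V P) = card V choose s"
proof -
  have sub: "A \<subseteq> V" "card A = q" "finite A" if "A \<in> P" for A
    using that assms(2) by (auto simp: packing_def nsets_def)
  have finP: "finite P" using packing_finite assms by blast
  have "card (\<Union>B\<in>P. nsets B s) = (\<Sum>B\<in>P. card (nsets B s))"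
  proof (rule card_UN_disjoint)
    show "finite P" by (rule finP)
    show "\<forall>B\<in>P. finite (nsets B s)" using sub finite_imp_finite_nsets by blast
    show "\<forall>A\<in>P. \<forall>B\<in>P. A \<noteq> B \<longrightarrow> nsets A s \<inter> nsets B s = {}"
    proof (intro ballI impI equals0I)
      fix A B S assume AB: "A \<in> P" "B \<in> P" "A \<noteq> B" and "S \<in> nsets A s \<inter> nsets B s"
      then have S: "S \<subseteq> A \<inter> B" "card S = s" by (auto simp: nsets_def)
      then have "s \<le> card (A \<inter> B)" using sub(3)[OF AB(1)] card_mono[of "A \<inter> B" S] by auto
      then show False using AB assms(2) unfolding packing_def by fastforce
    qed
  qed
  also have "\<dots> = (q choose s) * card P" using sub by simp
  finally have 1: "card (\<Union>B\<in>P. nsets B s) = (q choose s) * card P" .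
  have 2: "nsets V s = (\<Union>B\<in>P. nsets B s) \<union> uncovered s V P"
    using sub unfolding uncovered_def nsets_def by blast
  have 3: "(\<Union>B\<in>P. nsets B s) \<inter> uncovered s V P = {}"
    unfolding uncovered_def nsets_def by blast
  have fin: "finite (nsets V s)" using finite_imp_finite_nsets assms by blast
  have "card (nsets V s) = card (\<Union>B\<in>P. nsets B s) + card (uncovered s V P)"
    using card_Un_disjoint[OF _ _ 3] fin unfolding 2 by (metis finite_Un)
  then show ?thesis using 1 by simp
qed

text \<open>
  A maximal packing inside \<open>Q\<close> is large: every member of \<open>Q\<close> contains one of the \<open>s\<close>-sets
  covered by it, and each \<open>s\<close>-set lies in at most \<open>card V ^ (q - s)\<close> sets of size \<open>q\<close>.
\<close>
lemma greedy_packing: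
  assumes "finite V" "Q \<subseteq> nsets V q" "s \<le> q"
  obtains X where "X \<subseteq> Q" "packing s q V X"
    "card Q \<le> card X * (q choose s) * card V ^ (q - s)"
proof -
  let ?\<P> = "{X. X \<subseteq> Q \<and> packing s q V X}"
  have finQ: "finite Q" using assms finite_imp_finite_nsets finite_subset by blast
  have fin: "finite ?\<P>" by (rule finite_subset[of _ "Pow Q"]) (auto simp: finQ)
  have ne: "{} \<in> ?\<P>" using packing_empty by blast
  obtain X where X: "X \<in> ?\<P>" and max: "\<And>Y. Y \<in> ?\<P> \<Longrightarrow> X \<subseteq> Y \<Longrightarrow> Y = X"
    using finite_has_maximal2[OF fin ne] by metis
  have XQ: "X \<subseteq> Q" and pX: "packing s q V X" using X by auto
  have finX: "finite X" using packing_finite[OF assms(1) pX] .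
  let ?E = "\<lambda>S. {A \<in> nsets V q. S \<subseteq> A}"
  have cover: "Q \<subseteq> (\<Union>B\<in>X. \<Union>S\<in>nsets B s. ?E S)"
  proof
    fix A assume A: "A \<in> Q"
    have A': "A \<in> nsets V q" using A assms by auto
    have "\<exists>B\<in>X. s \<le> card (A \<inter> B)"
    proof (cases "A \<in> X")
      case True
      then show ?thesis using A' assms(3) by (auto simp: nsets_def intro!: bexI[of _ A])
    next
      case False
      show ?thesis
      proof (rule ccontr)
        assume "\<not> ?thesis"
        then have "packing s q V (insert A X)"
          using pX A' unfolding packing_def by (auto simp: Int_commute not_le)
        then have "insert A X \<in> ?\<P>" using A XQ by auto
        then show False using max[of "insert A X"] False by auto
      qed
    qed
    then obtain B where B: "B \<in> X" "s \<le> card (A \<inter> B)" by blast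
    obtain S where "S \<subseteq> A \<inter> B" "card S = s" "finite S" using B(2) obtain_subset_with_card_n by metis
    then show "A \<in> (\<Union>B\<in>X. \<Union>S\<in>nsets B s. ?E S)" using B(1) A' by (auto simp: nsets_def)
  qed
  have E: "card (?E S) \<le> card V ^ (q - s)" if "S \<in> nsets B s" "B \<in> X" for S B
  proof -
    have S: "finite S" "card S = s" using that by (auto simp: nsets_def)
    have "inj_on (\<lambda>A. A - S) (?E S)" by (rule inj_onI) blast
    moreover have "(\<lambda>A. A - S) ` ?E S \<subseteq> nsets V (q - s)"
      using S by (auto simp: nsets_def card_Diff_subset)
    ultimately have "card (?E S) \<le> card (nsets V (q - s))"
      by (rule card_inj_on_le[OF _ _ finite_imp_finite_nsets[OF assms(1)]])
    also have "\<dots> = card V choose (q - s)" by simp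
    also have "\<dots> \<le> card V ^ (q - s)" 
      by (cases "q - s \<le> card V") (auto intro: binomial_le_pow simp: binomial_eq_0)
    finally show ?thesis .
  qed
  have fB: "finite B" "card B = q" if "B \<in> X" for B using that pX by (auto simp: packing_def nsets_def)
  have finE: "finite (?E S)" for S using finite_imp_finite_nsets[OF assms(1), of q] by simp
  have "card Q \<le> card (\<Union>B\<in>X. \<Union>S\<in>nsets B s. ?E S)"
    by (intro card_mono cover finite_UN_I finX finite_imp_finite_nsets finE fB(1))
  also have "\<dots> \<le> (\<Sum>B\<in>X. card (\<Union>S\<in>nsets B s. ?E S))" by (rule card_UN_le[OF finX])
  also have "\<dots> \<le> (\<Sum>B\<in>X. (q choose s) * card V ^ (q - s))"
  proof (rule sum_mono)
    fix B assume B: "B \<in> X"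
    have "card (\<Union>S\<in>nsets B s. ?E S) \<le> (\<Sum>S\<in>nsets B s. card (?E S))"
      by (rule card_UN_le) (use fB B finite_imp_finite_nsets in auto)
    also have "\<dots> \<le> (\<Sum>S\<in>nsets B s. card V ^ (q - s))" by (rule sum_mono) (use E B in blast)
    also have "\<dots> = (q choose s) * card V ^ (q - s)" using fB B by simp
    finally show "card (\<Union>S\<in>nsets B s. ?E S) \<le> (q choose s) * card V ^ (q - s)" .
  qed
  also have "\<dots> = card X * (q choose s) * card V ^ (q - s)" by simp
  finally show ?thesis using that[OF XQ pX] by simp
qed

section \<open>Permuted copies of a packing\<close>

text \<open>
  The part of the graph of \<open>g\<close> above \<open>A\<close>. The points of the product \<open>{..<K} \<times> {..<M}\<close> are
  pairs of a column and a height; the sets \<open>lift g A\<close> are those that meet every column in at most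
  one point.
\<close>
definition lift :: "(nat \<Rightarrow> nat) \<Rightarrow> nat set \<Rightarrow> (nat \<times> nat) set" where
  "lift g A = (\<lambda>i. (i, g i)) ` A"

lemma card_lift: "card (lift g A) = card A"
  unfolding lift_def by (rule card_image) (auto intro: inj_onI)

lemma fst_lift: "fst ` lift g A = A"
  unfolding lift_def by force

lemma lift_Int: "lift g A \<inter> lift g' B = lift g {i \<in> A \<inter> B. g i = g' i}"
  unfolding lift_def by auto

lemma permutes_mapping:
  assumes "finite V" "I \<subseteq> V" "I' \<subseteq> V" "card I = card I'"
  obtains \<sigma> where "\<sigma> permutes V" "\<sigma> ` I = I'"
proof -
  have fin: "finite I" "finite I'" using assms finite_subset by blast+
  obtain u where u: "bij_betw u I I'" using finite_same_card_bij[OF fin assms(4)] by blast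
  have "card (V - I) = card (V - I')" using assms fin by (simp add: card_Diff_subset)
  then obtain w where w: "bij_betw w (V - I) (V - I')"
    using finite_same_card_bij assms(1) by (metis finite_Diff)
  define \<sigma> where "\<sigma> = (\<lambda>x. if x \<in> I then u x else if x \<in> V then w x else x)"
  have 1: "bij_betw \<sigma> I I'" using u by (simp add: \<sigma>_def cong: bij_betw_cong)
  have 2: "bij_betw \<sigma> (V - I) (V - I')"
    using w by (subst bij_betw_cong[of _ _ w]) (auto simp: \<sigma>_def)
  have "bij_betw \<sigma> (I \<union> (V - I)) (I' \<union> (V - I'))"
    by (rule bij_betw_combine[OF 1 2]) auto
  then have "bij_betw \<sigma> V V" using assms by (simp add: Un_absorb1)
  then have "\<sigma> permutes V" by (rule bij_imp_permutes) (use assms in \<open>auto simp: \<sigma>_def\<close>)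
  moreover have "\<sigma> ` I = I'" using 1 by (simp add: bij_betw_def)
  ultimately show ?thesis by (rule that)
qed

text \<open>
  The permutations \<open>p\<close> of \<open>V\<close> for which the permuted packing leaves \<open>I\<close> uncovered. By symmetry
  their proportion among all permutations is the proportion of uncovered \<open>s\<close>-sets, whatever the
  \<open>s\<close>-set \<open>I\<close> is.
\<close>
definition avoiding :: "'a set \<Rightarrow> 'a set set \<Rightarrow> 'a set \<Rightarrow> ('a \<Rightarrow> 'a) set" where
  "avoiding V P I = {p. p permutes V \<and> (\<forall>B\<in>P. \<not> I \<subseteq> p ` B)}"

lemma card_avoiding_le:
  assumes V: "finite V" and I: "I \<in> nsets V s" and I': "I' \<in> nsets V s"
  shows "card (avoiding V P I) \<le> card (avoiding V P I')"
proof -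
  obtain \<sigma> where \<sigma>: "\<sigma> permutes V" "\<sigma> ` I = I'"
    using permutes_mapping[OF V, of I I'] I I' by (auto simp: nsets_def)
  have inj: "inj \<sigma>" using \<sigma>(1) permutes_inj by blast
  have "finite {p. p permutes V}" using V finite_permutations by blast
  then have fin: "finite (avoiding V P I')"
    by (rule rev_finite_subset) (auto simp: avoiding_def)
  have "inj_on ((\<circ>) \<sigma>) (avoiding V P I)"
    using fun.inj_map[OF inj] inj_on_subset by blast
  moreover have "(\<circ>) \<sigma> ` avoiding V P I \<subseteq> avoiding V P I'"
  proof
    fix p' assume "p' \<in> (\<circ>) \<sigma> ` avoiding V P I"
    then obtain p where p: "p' = \<sigma> \<circ> p" "p permutes V" "\<forall>B\<in>P. \<not> I \<subseteq> p ` B"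
      by (auto simp: avoiding_def)
    have "\<not> I' \<subseteq> p' ` B" if "B \<in> P" for B
      using p(3) that unfolding p(1) image_comp[symmetric] \<sigma>(2)[symmetric]
      by (simp add: inj_image_subset_iff[OF inj])
    then show "p' \<in> avoiding V P I'"
      unfolding avoiding_def using permutes_compose[OF p(2) \<sigma>(1)] p(1) by simp
  qed
  ultimately show ?thesis using card_inj_on_le fin by metis
qed

lemma card_avoiding:
  assumes V: "finite V" and I: "I \<in> nsets V s"
  shows "card (avoiding V P I) * (card V choose s) = fact (card V) * card (uncovered s V P)"
proof -
  let ?S = "nsets V s" and ?G = "{p. p permutes V}"
  have finS: "finite ?S" using finite_imp_finite_nsets V by blast
  have finG: "finite ?G" using V finite_permutations by blast
  have "card (avoiding V P I) * (card V choose s) = (\<Sum>J\<in>?S. card (avoiding V P J))"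
  proof -
    have "card (avoiding V P J) = card (avoiding V P I)" if "J \<in> ?S" for J
      using card_avoiding_le[OF V] that I by (simp add: le_antisym)
    then show ?thesis by simp
  qed
  also have "\<dots> = (\<Sum>J\<in>?S. card {p\<in>?G. \<forall>B\<in>P. \<not> J \<subseteq> p ` B})"
    by (simp add: avoiding_def)
  \<comment> \<open>double counting of the pairs of a permutation and an \<open>s\<close>-set left uncovered by it\<close>
  also have "\<dots> = (\<Sum>p\<in>?G. card {J\<in>?S. \<forall>B\<in>P. \<not> J \<subseteq> p ` B})"
    by (rule sum_multicount_gen[OF finG finS, symmetric, where k="\<lambda>J. card {p\<in>?G. \<forall>B\<in>P. \<not> J \<subseteq> p ` B}"]) simp
  also have "\<dots> = (\<Sum>p\<in>?G. card (uncovered s V P))"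
  proof (rule sum.cong[OF refl])
    fix p assume "p \<in> ?G"
    then have p: "p permutes V" by simp
    have injp: "inj p" using p permutes_inj by blast
    have imV: "p ` V = V" using p permutes_image by blast
    have "{J\<in>?S. \<forall>B\<in>P. \<not> J \<subseteq> p ` B} = (`) p ` uncovered s V P"
    proof (intro equalityI subsetI)
      fix J assume "J \<in> {J\<in>?S. \<forall>B\<in>P. \<not> J \<subseteq> p ` B}"
      then have J: "J \<subseteq> V" "finite J" "card J = s" "\<forall>B\<in>P. \<not> J \<subseteq> p ` B" by (auto simp: nsets_def)
      then obtain S where S: "S \<subseteq> V" "J = p ` S" using imV by (metis subset_image_iff)
      have "S \<in> uncovered s V P"
        using J S injp unfolding uncovered_def nsets_def
        by (auto simp: card_image inj_on_subset finite_image_iff inj_image_subset_iff)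
      then show "J \<in> (`) p ` uncovered s V P" using S by blast
    next
      fix J assume "J \<in> (`) p ` uncovered s V P"
      then obtain S where S: "S \<in> nsets V s" "\<forall>B\<in>P. \<not> S \<subseteq> B" "J = p ` S"
        by (auto simp: uncovered_def)
      moreover have "p ` S \<subseteq> V" using S(1) imV by (auto simp: nsets_def)
      ultimately show "J \<in> {J\<in>?S. \<forall>B\<in>P. \<not> J \<subseteq> p ` B}"
        using injp inj_image_subset_iff[OF injp]
        by (auto simp: nsets_def card_image inj_on_subset)
    qed
    moreover have "inj_on ((`) p) (uncovered s V P)"
      using injp by (simp add: inj_on_def inj_image_eq_iff)
    ultimately show "card {J\<in>?S. \<forall>B\<in>P. \<not> J \<subseteq> p ` B} = card (uncovered s V P)"
      by (simp add: card_image)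
  qed
  also have "\<dots> = fact (card V) * card (uncovered s V P)"
    using card_permutations[OF refl V] by simp
  finally show ?thesis .
qed

text \<open>
  An indexed family whose members overlap in fewer than \<open>s \<le> q\<close> points is a packing, and no block
  is repeated.
\<close>
lemma packing_imageI:
  assumes s: "s \<le> q" and sub: "\<And>x. x \<in> X \<Longrightarrow> \<phi> x \<in> nsets V q"
    and int: "\<And>x y. x \<in> X \<Longrightarrow> y \<in> X \<Longrightarrow> x \<noteq> y \<Longrightarrow> card (\<phi> x \<inter> \<phi> y) < s"
  shows "packing s q V (\<phi> ` X)" "inj_on \<phi> X"
proof -
  show "packing s q V (\<phi> ` X)" unfolding packing_def using sub int by blast
  show "inj_on \<phi> X"
  proof (rule inj_onI, rule ccontr)
    fix x y assume xy: "x \<in> X" "y \<in> X" "\<phi> x = \<phi> y" "x \<noteq> y"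
    then have "card (\<phi> x) < s" using int[of x y] by simp
    then show False using sub[OF xy(1)] s by (simp add: nsets_def)
  qed
qed

section \<open>The randomised product of packings\<close>

context polynomial_code
begin

text \<open>
  The graph of each polynomial \<open>f\<close> is a copy of \<open>{..<K}\<close>, and different graphs share fewer than
  \<open>s\<close> points. Each of them is filled with a copy of the packing \<open>P\<close>, permuted by \<open>\<pi> f\<close>.
\<close>
definition glued :: "nat set set \<Rightarrow> ((nat \<Rightarrow> nat) \<Rightarrow> nat \<Rightarrow> nat) \<Rightarrow> (nat \<times> nat) set set" where
  "glued P \<pi> = (\<lambda>(f, B). lift (ev f) (\<pi> f ` B)) ` (polys \<times> P)"

lemma glued_packing:
  assumes P: "packing s q {..<K} P" and q: "s \<le> q"
    and \<pi>: "\<And>f. f \<in> polys \<Longrightarrow> \<pi> f permutes {..<K}"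
  shows "packing s q ({..<K} \<times> {..<M}) (glued P \<pi>)" "card (glued P \<pi>) = M ^ s * card P"
proof -
  let ?\<phi> = "\<lambda>(f, B). lift (ev f) (\<pi> f ` B)"
  have B: "B \<subseteq> {..<K}" "finite B" "card B = q" if "B \<in> P" for B
    using P that by (auto simp: packing_def nsets_def)
  have \<pi>B: "\<pi> f ` B \<subseteq> {..<K}" "card (\<pi> f ` B) = q" if "f \<in> polys" "B \<in> P" for f B
    using B[OF that(2)] permutes_image[OF \<pi>[OF that(1)]] permutes_inj[OF \<pi>[OF that(1)]]
    by (auto simp: card_image inj_on_subset)
  have sub: "?\<phi> x \<in> nsets ({..<K} \<times> {..<M}) q" if "x \<in> polys \<times> P" for x
  proof -
    obtain f B' where x: "x = (f, B')" "f \<in> polys" "B' \<in> P" using \<open>x \<in> polys \<times> P\<close> by auto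
    have "lift (ev f) (\<pi> f ` B') \<subseteq> {..<K} \<times> {..<M}"
      using \<pi>B(1)[OF x(2,3)] ev_less by (auto simp: lift_def)
    then show ?thesis
      using \<pi>B(2)[OF x(2,3)] finite_subset[of _ "{..<K} \<times> {..<M}"]
      by (simp add: x(1) nsets_def card_lift)
  qed
  have int: "card (?\<phi> x \<inter> ?\<phi> y) < s" if "x \<in> polys \<times> P" "y \<in> polys \<times> P" "x \<noteq> y" for x y
  proof -
    obtain f A f' A' where x: "x = (f, A)" "f \<in> polys" "A \<in> P" and y: "y = (f', A')" "f' \<in> polys" "A' \<in> P"
      using \<open>x \<in> polys \<times> P\<close> \<open>y \<in> polys \<times> P\<close> by auto
    show ?thesis
    proof (cases "f = f'")
      case True
      then have "card (A \<inter> A') < s" using that(3) x y P by (auto simp: packing_def)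
      moreover have "?\<phi> x \<inter> ?\<phi> y = lift (ev f) (\<pi> f ` (A \<inter> A'))"
        using True image_Int[OF permutes_inj[OF \<pi>[OF x(2)]], of A A']
        by (simp add: x y lift_Int Int_def[symmetric])
      moreover have "card (\<pi> f ` (A \<inter> A')) \<le> card (A \<inter> A')"
        by (rule card_image_le) (use B x in auto)
      ultimately show ?thesis by (simp add: card_lift)
    next
      case False
      let ?I = "{i \<in> \<pi> f ` A \<inter> \<pi> f' ` A'. ev f i = ev f' i}"
      have sub: "?I \<subseteq> {..<K}" using \<pi>B(1)[OF x(2,3)] by auto
      have "\<not> s \<le> card ?I"
      proof
        assume "s \<le> card ?I"
        then have "f = f'" by (rule agree_unique[OF x(2) y(2) sub]) simp
        then show False using False by simp
      qed
      then show ?thesis by (simp add: x y lift_Int card_lift)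
    qed
  qed
  note * = packing_imageI[OF q sub int, where X = "polys \<times> P"]
  show "packing s q ({..<K} \<times> {..<M}) (glued P \<pi>)" unfolding glued_def by (rule *)
  have "inj_on ?\<phi> (polys \<times> P)" by (rule *)
  then show "card (glued P \<pi>) = M ^ s * card P"
    unfolding glued_def by (simp add: card_image card_cartesian_product card_polys)
qed

text \<open>
  A transversal with set of columns \<open>J\<close> is given by a function \<open>g\<close> on \<open>J\<close>. It is generic if its
  \<open>s\<close>-subsets lie on distinct polynomials, so that independent choices decide about them.
\<close>
definition generic :: "nat set \<Rightarrow> (nat \<Rightarrow> nat) set" where
  "generic J = {g \<in> J \<rightarrow>\<^sub>E {..<M}. inj_on (interp g) (nsets J s)}"

lemma finite_generic: "finite J \<Longrightarrow> finite (generic J)"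
  unfolding generic_def by (rule finite_subset[of _ "J \<rightarrow>\<^sub>E {..<M}"]) (auto intro: finite_PiE)

lemma card_PiE_determined:
  assumes J: "finite J" "i \<in> J" and T: "T \<subseteq> (J \<rightarrow>\<^sub>E {..<M})"
    and det: "\<And>g g'. g \<in> T \<Longrightarrow> g' \<in> T \<Longrightarrow> (\<And>j. j \<in> J - {i} \<Longrightarrow> g j = g' j) \<Longrightarrow> g i = g' i"
  shows "card T \<le> M ^ (card J - 1)"
proof -
  let ?r = "\<lambda>g. restrict g (J - {i})"
  have "inj_on ?r T"
  proof (rule inj_onI)
    fix g g' assume g: "g \<in> T" "g' \<in> T" "?r g = ?r g'"
    have eq: "g j = g' j" if "j \<in> J - {i}" for j using fun_cong[OF g(3), of j] that by simp
    have "g i = g' i" using det[OF g(1,2) eq] .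
    then have "g j = g' j" if "j \<in> J" for j using eq[of j] that by (cases "j = i") auto
    then show "g = g'" using T g(1,2) by (intro PiE_ext[of g J "\<lambda>_. {..<M}" g']) auto
  qed
  moreover have "?r ` T \<subseteq> (J - {i} \<rightarrow>\<^sub>E {..<M})"
  proof (rule image_subsetI)
    fix g assume "g \<in> T"
    then have "g \<in> J \<rightarrow>\<^sub>E {..<M}" using T by blast
    then show "?r g \<in> J - {i} \<rightarrow>\<^sub>E {..<M}" unfolding restrict_PiE_iff by blast
  qed
  moreover have "finite (J - {i} \<rightarrow>\<^sub>E {..<M})" using J by (intro finite_PiE) auto
  ultimately have "card T \<le> card (J - {i} \<rightarrow>\<^sub>E {..<M})" by (rule card_inj_on_le)
  then show ?thesis using J by (simp add: card_PiE)
qed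

lemma interp_nsets:
  assumes "J \<subseteq> {..<K}" "g \<in> J \<rightarrow>\<^sub>E {..<M}" "I \<in> nsets J s"
  shows "interp g I \<in> polys"
  by (rule interp(1)) (use assms in \<open>auto simp: nsets_def\<close>)

text \<open>
  For a transversal that is not generic, some value \<open>g i\<close> is the value at \<open>i\<close> of the polynomial
  through \<open>s\<close> of the other points. So only \<open>O(M ^ (q - 1))\<close> of the \<open>M ^ q\<close> transversals above \<open>J\<close>
  are not generic.
\<close>
lemma card_generic:
  assumes J: "J \<subseteq> {..<K}" "card J = q"
  shows "M ^ q \<le> card (generic J) + (q choose s) * q * M ^ (q - 1)"
proof -
  have finJ: "finite J" using J finite_subset by blast
  let ?T = "\<lambda>I i. {g \<in> J \<rightarrow>\<^sub>E {..<M}. g i = ev (interp g I) i}"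
  let ?bad = "\<Union>I\<in>nsets J s. \<Union>i\<in>J - I. ?T I i"
  have finPi: "finite (J \<rightarrow>\<^sub>E {..<M})" using finJ by (intro finite_PiE) auto
  have "(J \<rightarrow>\<^sub>E {..<M}) \<subseteq> generic J \<union> ?bad"
  proof
    fix g assume g: "g \<in> J \<rightarrow>\<^sub>E {..<M}"
    show "g \<in> generic J \<union> ?bad"
    proof (cases "inj_on (interp g) (nsets J s)")
      case True
      then show ?thesis using g by (simp add: generic_def)
    next
      case False
      then obtain I I' where I: "I \<in> nsets J s" "I' \<in> nsets J s" "I \<noteq> I'" "interp g I = interp g I'"
        unfolding inj_on_def by blast
      then have "\<not> I' \<subseteq> I"
        using card_subset_eq[of I I'] by (auto simp: nsets_def)
      then obtain i where i: "i \<in> I'" "i \<notin> I" by blast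
      have "g i = ev (interp g I') i"
        by (rule interp(2)[symmetric]) (use I i J g in \<open>auto simp: nsets_def\<close>)
      then have "g \<in> ?T I i" using g I(4) by simp
      moreover have "i \<in> J - I" using i I by (auto simp: nsets_def)
      ultimately show ?thesis using I(1) by blast
    qed
  qed
  then have "card (J \<rightarrow>\<^sub>E {..<M}) \<le> card (generic J \<union> ?bad)"
    by (intro card_mono finite_UnI finite_generic[OF finJ] finite_subset[OF _ finPi, of ?bad]) auto
  also have "\<dots> \<le> card (generic J) + card ?bad" by (rule card_Un_le)
  finally have 1: "M ^ q \<le> card (generic J) + card ?bad" using finJ J by (simp add: card_PiE)
  have T: "card (?T I i) \<le> M ^ (q - 1)" if I: "I \<in> nsets J s" "i \<in> J - I" for I i
    unfolding J(2)[symmetric]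
  proof (rule card_PiE_determined[OF finJ, of i])
    fix g g' assume g: "g \<in> ?T I i" "g' \<in> ?T I i" and eq: "\<And>j. j \<in> J - {i} \<Longrightarrow> g j = g' j"
    have I': "I \<subseteq> {..<K}" "card I = s" "I \<subseteq> J - {i}" using I J by (auto simp: nsets_def)
    have "interp g I = interp g' I"
    proof (rule interp_eqI[OF I'(1,2)])
      show "g \<in> I \<rightarrow> {..<M}" using g(1) I'(3) by auto
      have g': "g' \<in> I \<rightarrow> {..<M}" using g(2) I'(3) by auto
      show "interp g' I \<in> polys" by (rule interp(1)[OF I'(1,2) g'])
      show "ev (interp g' I) j = g j" if "j \<in> I" for j
        using interp(2)[OF I'(1,2) g' that] eq[OF subsetD[OF I'(3) that]] by simp
    qed
    then show "g i = g' i" using g by simp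
  qed (use I in auto)
  have "card ?bad \<le> (\<Sum>I\<in>nsets J s. card (\<Union>i\<in>J - I. ?T I i))"
    by (rule card_UN_le[OF finite_imp_finite_nsets[OF finJ]])
  also have "\<dots> \<le> (\<Sum>I\<in>nsets J s. q * M ^ (q - 1))"
  proof (rule sum_mono)
    fix I assume I: "I \<in> nsets J s"
    have "card (\<Union>i\<in>J - I. ?T I i) \<le> (\<Sum>i\<in>J - I. card (?T I i))"
      by (rule card_UN_le) (use finJ in simp)
    also have "\<dots> \<le> (\<Sum>i\<in>J - I. M ^ (q - 1))" by (rule sum_mono) (use T I in blast)
    also have "\<dots> = card (J - I) * M ^ (q - 1)" by simp
    also have "card (J - I) \<le> q" using card_mono[OF finJ, of "J - I"] J by auto
    finally show "card (\<Union>i\<in>J - I. ?T I i) \<le> q * M ^ (q - 1)" by simp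
  qed
  also have "\<dots> = (q choose s) * q * M ^ (q - 1)" using J by simp
  finally show ?thesis using 1 by linarith
qed

text \<open>
  The glued packing covers no \<open>s\<close>-subset of the transversal given by \<open>J\<close> and \<open>g\<close>.
\<close>
definition free :: "nat set set \<Rightarrow> ((nat \<Rightarrow> nat) \<Rightarrow> nat \<Rightarrow> nat) \<Rightarrow> nat set \<Rightarrow> (nat \<Rightarrow> nat) \<Rightarrow> bool" where
  "free P \<pi> J g \<longleftrightarrow> (\<forall>I\<in>nsets J s. \<pi> (interp g I) \<in> avoiding {..<K} P I)"

lemma free_Int:
  assumes J: "J \<subseteq> {..<K}" and g: "g \<in> J \<rightarrow>\<^sub>E {..<M}" and free: "free P \<pi> J g" and A: "A \<in> glued P \<pi>"
  shows "card (lift g J \<inter> A) < s"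
proof (rule ccontr)
  assume *: "\<not> ?thesis"
  obtain f B where fB: "f \<in> polys" "B \<in> P" "A = lift (ev f) (\<pi> f ` B)" using A by (auto simp: glued_def)
  have "s \<le> card {i \<in> J \<inter> \<pi> f ` B. g i = ev f i}" using * by (simp add: fB(3) lift_Int card_lift)
  then obtain I where I: "I \<subseteq> {i \<in> J \<inter> \<pi> f ` B. g i = ev f i}" "card I = s" "finite I"
    by (rule obtain_subset_with_card_n)
  then have "interp g I = f" using J g fB(1) by (intro interp_eqI) auto
  moreover have "I \<in> nsets J s" using I by (auto simp: nsets_def)
  ultimately have "\<pi> f \<in> avoiding {..<K} P I" using free by (auto simp: free_def)
  then show False using I fB(2) by (auto simp: avoiding_def)
qed

text \<open>
  The sample space: an independent permutation of the columns for each polynomial.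
\<close>
definition perm_choices :: "((nat \<Rightarrow> nat) \<Rightarrow> nat \<Rightarrow> nat) set" where
  "perm_choices = (polys \<rightarrow>\<^sub>E {p. p permutes {..<K}})"

lemma card_perm_choices: "card perm_choices = fact K ^ card polys"
  using card_permutations[of "{..<K}" K] by (simp add: perm_choices_def card_PiE finite_polys)

lemma finite_perm_choices: "finite perm_choices"
  unfolding perm_choices_def by (intro finite_PiE finite_polys finite_permutations) simp

text \<open>
  The proportion of \<open>s\<close>-subsets of \<open>{..<K}\<close> that the packing \<open>P\<close> leaves uncovered.
\<close>
definition waste :: "nat set set \<Rightarrow> real" where
  "waste P = card (uncovered s {..<K} P) / (K choose s)"

text \<open>
  The \<open>q choose s\<close> subsets of a generic transversal involve different permutations, hence they are
  uncovered independently, each with probability \<open>waste P\<close>.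
\<close>
lemma card_free_choices:
  assumes J: "J \<subseteq> {..<K}" "card J = q" and sK: "s \<le> K" and g: "g \<in> generic J"
  shows "real (card {\<pi> \<in> perm_choices. free P \<pi> J g}) = card perm_choices * waste P ^ (q choose s)"
proof -
  have finJ: "finite J" using J finite_subset by blast
  have gJ: "g \<in> J \<rightarrow>\<^sub>E {..<M}" and inj: "inj_on (interp g) (nsets J s)" using g by (auto simp: generic_def)
  let ?F = "interp g ` nsets J s"
  have Fsub: "?F \<subseteq> polys" using interp_nsets[OF J(1) gJ] by blast
  define S where "S f = {p. p permutes {..<K} \<and> (\<forall>I\<in>nsets J s. interp g I = f \<longrightarrow> p \<in> avoiding {..<K} P I)}" for f
  have "{\<pi> \<in> perm_choices. free P \<pi> J g} = (\<Pi>\<^sub>E f\<in>polys. S f)"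
    unfolding perm_choices_def free_def S_def using Fsub by (fastforce simp: PiE_iff)
  then have "real (card {\<pi> \<in> perm_choices. free P \<pi> J g}) = (\<Prod>f\<in>polys. real (card (S f)))"
    by (simp add: card_PiE finite_polys)
  also have "\<dots> = (\<Prod>f\<in>polys. fact K * (if f \<in> ?F then waste P else 1))"
  proof (rule prod.cong[OF refl])
    fix f assume "f \<in> polys"
    show "real (card (S f)) = fact K * (if f \<in> ?F then waste P else 1)"
    proof (cases "f \<in> ?F")
      case True
      then obtain I where I: "I \<in> nsets J s" "f = interp g I" by blast
      then have "S f = avoiding {..<K} P I"
        unfolding S_def using inj by (auto simp: inj_on_def avoiding_def)
      moreover have "I \<in> nsets {..<K} s" using I(1) J(1) nsets_mono by blast
      then have "card (avoiding {..<K} P I) * (K choose s) = fact K * card (uncovered s {..<K} P)"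
        using card_avoiding[of "{..<K}" I s P] by simp
      then have "real (card (avoiding {..<K} P I)) * real (K choose s) = fact K * real (card (uncovered s {..<K} P))"
        by (metis of_nat_fact of_nat_mult)
      moreover have "real (K choose s) > 0" using sK by simp
      ultimately show ?thesis using True by (simp add: waste_def field_simps)
    next
      case False
      then have "S f = {p. p permutes {..<K}}" by (auto simp: S_def)
      then show ?thesis using False card_permutations[of "{..<K}" K] by simp
    qed
  qed
  also have "\<dots> = fact K ^ card polys * (\<Prod>f\<in>polys. if f \<in> ?F then waste P else 1)"
    by (simp add: prod.distrib)
  also have "(\<Prod>f\<in>polys. if f \<in> ?F then waste P else 1) = (\<Prod>f\<in>?F. waste P)"
    using Fsub finite_polys by (simp add: prod.If_cases Int_absorb1)
  also have "\<dots> = waste P ^ (q choose s)" using card_image[OF inj] J by simp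
  finally show ?thesis by (simp add: card_perm_choices)
qed

text \<open>
  Some choice of permutations does at least as well as the average.
\<close>
lemma many_free:
  assumes sK: "s \<le> K"
  obtains \<pi> where "\<And>f. f \<in> polys \<Longrightarrow> \<pi> f permutes {..<K}"
    "real (card {(J, g). J \<in> nsets {..<K} q \<and> g \<in> generic J \<and> free P \<pi> J g})
      \<ge> (K choose q) * waste P ^ (q choose s) * (real M ^ q - (q choose s) * q * real M ^ (q - 1))"
proof -
  let ?G = "SIGMA J : nsets {..<K} q. generic J"
  let ?b = "(K choose q) * waste P ^ (q choose s) * (real M ^ q - (q choose s) * q * real M ^ (q - 1))"
  have finG: "finite ?G"
    by (intro finite_SigmaI finite_imp_finite_nsets finite_generic) (auto simp: nsets_def)
  have w0: "0 \<le> waste P" by (simp add: waste_def)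
  have "(K choose q) * (real M ^ q - (q choose s) * q * real M ^ (q - 1))
      = (\<Sum>J\<in>nsets {..<K} q. real M ^ q - (q choose s) * q * real M ^ (q - 1))" by simp
  also have "\<dots> \<le> (\<Sum>J\<in>nsets {..<K} q. real (card (generic J)))"
  proof (rule sum_mono)
    fix J assume "J \<in> nsets {..<K} q"
    then have "M ^ q \<le> card (generic J) + (q choose s) * q * M ^ (q - 1)"
      by (intro card_generic) (auto simp: nsets_def)
    then have "real (M ^ q) \<le> real (card (generic J) + (q choose s) * q * M ^ (q - 1))"
      using of_nat_le_iff by blast
    then show "real M ^ q - (q choose s) * q * real M ^ (q - 1) \<le> real (card (generic J))" by simp
  qed
  also have "\<dots> = real (card ?G)"
    by (subst card_SigmaI) (auto simp: finite_imp_finite_nsets intro!: finite_generic simp: nsets_def)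
  finally have G: "(K choose q) * (real M ^ q - (q choose s) * q * real M ^ (q - 1)) \<le> real (card ?G)" .
  have "(\<Sum>\<pi>\<in>perm_choices. ?b) = card perm_choices * ?b" by simp
  also have "\<dots> \<le> card perm_choices * (real (card ?G) * waste P ^ (q choose s))"
    using mult_right_mono[OF G, of "waste P ^ (q choose s)"] w0
    by (intro mult_left_mono) (simp_all add: algebra_simps)
  also have "\<dots> = (\<Sum>(J, g)\<in>?G. card perm_choices * waste P ^ (q choose s))" by simp
  also have "\<dots> = (\<Sum>(J, g)\<in>?G. real (card {\<pi> \<in> perm_choices. free P \<pi> J g}))"
    by (rule sum.cong) (auto simp: nsets_def sK intro!: card_free_choices[symmetric])
  also have "\<dots> = real (\<Sum>x\<in>?G. card {\<pi> \<in> perm_choices. free P \<pi> (fst x) (snd x)})"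
    by (simp add: case_prod_beta)
  also have "\<dots> = real (\<Sum>\<pi>\<in>perm_choices. card {x\<in>?G. free P \<pi> (fst x) (snd x)})"
    by (subst sum_multicount_gen[OF finite_perm_choices finG,
        where k="\<lambda>x. card {\<pi> \<in> perm_choices. free P \<pi> (fst x) (snd x)}"]) auto
  finally have le: "(\<Sum>\<pi>\<in>perm_choices. ?b) \<le> (\<Sum>\<pi>\<in>perm_choices. real (card {x\<in>?G. free P \<pi> (fst x) (snd x)}))"
    by simp
  have ne: "perm_choices \<noteq> {}" using card_perm_choices by fastforce
  obtain \<pi> where \<pi>: "\<pi> \<in> perm_choices" "?b \<le> real (card {x\<in>?G. free P \<pi> (fst x) (snd x)})"
    using sum_strict_mono[OF finite_perm_choices ne, of "\<lambda>\<pi>. real (card {x\<in>?G. free P \<pi> (fst x) (snd x)})" "\<lambda>_. ?b"] le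
    by (meson not_le)
  have "{x\<in>?G. free P \<pi> (fst x) (snd x)} = {(J, g). J \<in> nsets {..<K} q \<and> g \<in> generic J \<and> free P \<pi> J g}"
    by auto
  then show ?thesis using \<pi> by (intro that[of \<pi>]) (auto simp: perm_choices_def)
qed

text \<open>
  The amplification step: besides the \<open>M ^ s * card P\<close> blocks of the glued packing, a packing of
  \<open>K * M\<close> points has room for a number of further blocks that is of the same order of magnitude
  if \<open>waste P\<close> is bounded away from \<open>0\<close> and \<open>M\<close> is large. They come from the greedy choice among the free
  transversals.
\<close>
lemma pack_product:
  assumes sq: "s \<le> q" and qK: "q \<le> K" and P: "packing s q {..<K} P"
  shows "real (pack s q (K * M)) * ((q choose s) * real (K * M) ^ (q - s))
     \<ge> real (M ^ s * card P) * ((q choose s) * real (K * M) ^ (q - s))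
       + (K choose q) * waste P ^ (q choose s) * (real M ^ q - (q choose s) * q * real M ^ (q - 1))"
proof -
  let ?V = "{..<K} \<times> {..<M}"
  have sK: "s \<le> K" using sq qK by simp
  obtain \<pi> where \<pi>: "\<And>f. f \<in> polys \<Longrightarrow> \<pi> f permutes {..<K}" and
    many: "real (card {(J, g). J \<in> nsets {..<K} q \<and> g \<in> generic J \<and> free P \<pi> J g})
      \<ge> (K choose q) * waste P ^ (q choose s) * (real M ^ q - (q choose s) * q * real M ^ (q - 1))"
    using many_free[OF sK, of q P] by blast
  let ?F = "{(J, g). J \<in> nsets {..<K} q \<and> g \<in> generic J \<and> free P \<pi> J g}"
  let ?Q = "(\<lambda>(J, g). lift g J) ` ?F"
  have Qsub: "?Q \<subseteq> nsets ?V q"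
  proof
    fix A assume "A \<in> ?Q"
    then obtain J g where A: "A = lift g J" "J \<in> nsets {..<K} q" "g \<in> J \<rightarrow>\<^sub>E {..<M}"
      by (auto simp: generic_def)
    then show "A \<in> nsets ?V q" by (auto simp: nsets_def card_lift) (auto simp: lift_def)
  qed
  have "inj_on (\<lambda>(J, g). lift g J) ?F"
  proof (rule inj_onI, clarify)
    fix J g J' g' assume J: "g \<in> generic J" "g' \<in> generic J'" and eq: "lift g J = lift g' J'"
    have JJ: "J = J'" using eq fst_lift by metis
    have "g i = g' i" if "i \<in> J" for i
    proof -
      have "(i, g i) \<in> lift g' J'" using that eq by (auto simp: lift_def)
      then show ?thesis by (auto simp: lift_def)
    qed
    then show "J = J' \<and> g = g'" using JJ J by (auto simp: generic_def intro: PiE_ext)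
  qed
  then have cardQ: "card ?Q = card ?F" by (rule card_image)
  obtain X where X: "X \<subseteq> ?Q" "packing s q ?V X" "card ?Q \<le> card X * (q choose s) * card ?V ^ (q - s)"
    using greedy_packing[OF _ Qsub sq] by blast
  have disj: "card (A \<inter> B) < s" if "A \<in> X" "B \<in> glued P \<pi>" for A B
  proof -
    obtain J g where "A = lift g J" "J \<in> nsets {..<K} q" "g \<in> generic J" "free P \<pi> J g"
      using \<open>A \<in> X\<close> X(1) by auto
    then show ?thesis using free_Int[of J g P \<pi> B] that(2) by (auto simp: generic_def nsets_def)
  qed
  note gl = glued_packing[OF P sq, of \<pi>, OF \<pi>]
  have "packing s q ?V (glued P \<pi> \<union> X)"
    by (rule packing_Un[OF gl(1) X(2) disj])
  then have "card (glued P \<pi> \<union> X) \<le> pack s q (K * M)"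
    by (intro card_packing_le_pack[of ?V]) auto
  moreover have "glued P \<pi> \<inter> X = {}"
  proof (rule equals0I)
    fix A assume "A \<in> glued P \<pi> \<inter> X"
    then have "card A < s" "card A = q" using disj[of A A] X(2) by (auto simp: packing_def nsets_def)
    then show False using sq by simp
  qed
  moreover have "finite X" "finite (glued P \<pi>)"
    using X(2) gl(1) packing_finite[of ?V] by auto
  ultimately have *: "M ^ s * card P + card X \<le> pack s q (K * M)"
    using gl(2) by (simp add: card_Un_disjoint)
  have "card ?F \<le> card X * (q choose s) * (K * M) ^ (q - s)" using X(3) cardQ by simp
  then have "real (card ?F) \<le> real (card X * (q choose s) * (K * M) ^ (q - s))"
    using of_nat_le_iff by blast
  also have "\<dots> = real (card X) * ((q choose s) * real (K * M) ^ (q - s))" by simp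
  finally have "real (card ?F) \<le> real (card X) * ((q choose s) * real (K * M) ^ (q - s))" .
  moreover have "real (M ^ s * card P + card X) * ((q choose s) * real (K * M) ^ (q - s))
     \<le> real (pack s q (K * M)) * ((q choose s) * real (K * M) ^ (q - s))"
    by (rule mult_right_mono) (use * of_nat_le_iff in \<open>auto simp del: of_nat_add of_nat_mult of_nat_power\<close>)
  ultimately show ?thesis using many by (simp add: algebra_simps)
qed

end

section \<open>Asymptotically optimal packings and coverings\<close>

lemma pack_le_binomial: "(q choose s) * pack s q n \<le> n choose s"
proof -
  obtain P where "packing s q {..<n} P" "card P = pack s q n" by (rule pack_attained)
  then show ?thesis using packing_count[of "{..<n}" s q P] by simp
qed

lemma pack_mono:
  assumes "k \<le> n"
  shows "pack s q k \<le> pack s q n"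
proof -
  obtain P where "packing s q {..<k} P" "card P = pack s q k" by (rule pack_attained)
  then show ?thesis using card_packing_le_pack[of "{..<k}" s q P n] assms by simp
qed

text \<open>
  The size of a largest packing, normalised by the asymptotic value \<open>n ^ s / (fact s * (q choose s))\<close>
  of the trivial upper bound.
\<close>
definition density :: "nat \<Rightarrow> nat \<Rightarrow> nat \<Rightarrow> real" where
  "density s q n = (q choose s) * fact s * pack s q n / real n ^ s"

text \<open>
  The proportion of \<open>s\<close>-sets left uncovered by a largest packing of \<open>n\<close> points.
\<close>
definition uncovered_share :: "nat \<Rightarrow> nat \<Rightarrow> nat \<Rightarrow> real" where
  "uncovered_share s q n = 1 - (q choose s) * pack s q n / (n choose s)"

lemma density_le_1: "density s q n \<le> 1"
proof (cases "n = 0")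
  case True
  have "(q choose s) * pack s q 0 \<le> 1" if "s = 0"
    using pack_le_binomial[of q s 0] that by simp
  then show ?thesis using True
    by (cases "s = 0") (simp_all add: density_def zero_power flip: of_nat_mult)
next
  case False
  have "real ((q choose s) * pack s q n * fact s) \<le> real ((n choose s) * fact s)"
    using mult_right_mono[OF pack_le_binomial[of q s n], of "fact s"] of_nat_le_iff by blast
  also have "\<dots> \<le> real (n ^ s)" using binomial_fact_pow[of n s] of_nat_le_iff by blast
  finally show ?thesis using False by (simp add: density_def field_simps)
qed

lemma binomial_asymp: "(\<lambda>n. (n choose s) * fact s / real n ^ s) \<longlonglongrightarrow> 1"
proof -
  have lim: "(\<lambda>n. \<Prod>i=0..<s. 1 - real i / real n) \<longlonglongrightarrow> (\<Prod>i=0..<s. 1 - 0)"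
    by (intro tendsto_prod tendsto_diff tendsto_const lim_const_over_n)
  have eq: "(\<Prod>i=0..<s. 1 - real i / real n) = (n choose s) * fact s / real n ^ s" if "n > 0" for n
  proof -
    have "(n choose s) * fact s = (\<Prod>i=0..<s. real n - real i)"
      using gbinomial_mult_fact[of s "real n"] by (simp add: binomial_gbinomial mult.commute)
    also have "\<dots> = (\<Prod>i=0..<s. real n * (1 - real i / real n))"
      using that by (intro prod.cong) (auto simp: field_simps)
    also have "\<dots> = real n ^ s * (\<Prod>i=0..<s. 1 - real i / real n)"
      by (simp add: prod.distrib)
    finally show ?thesis using that by simp
  qed
  have ev: "\<forall>\<^sub>F n in sequentially. (\<Prod>i=0..<s. 1 - real i / real n) = (n choose s) * fact s / real n ^ s"
    by (rule eventually_mono[OF eventually_gt_at_top[of 0]]) (rule eq)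
  show ?thesis using Lim_transform_eventually[OF lim ev] by simp
qed

lemma uncovered_share_eq:
  assumes "s \<le> n" "0 < n"
  shows "uncovered_share s q n = 1 - density s q n / ((n choose s) * fact s / real n ^ s)"
  using assms by (simp add: uncovered_share_def density_def)

context polynomial_code
begin

text \<open>
  The amplification step in terms of densities.
\<close>
lemma density_product:
  assumes sq: "s \<le> q" and qK: "q \<le> K"
  shows "density s q K + fact s * (K choose q) / real K ^ q * uncovered_share s q K ^ (q choose s)
            * (1 - (q choose s) * q / M) \<le> density s q (K * M)"
proof -
  obtain P where P: "packing s q {..<K} P" "card P = pack s q K" by (rule pack_attained)
  have K0: "0 < K" using s_pos sq qK by simp
  have q0: "0 < q" using s_pos sq by simp
  have Kpos: "real K > 0" and Mpos: "real M > 0" using K0 M_pos by simp_all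
  have "real (K choose s) > 0" using sq qK by simp
  moreover have "real (q choose s) * card P + card (uncovered s {..<K} P) = (K choose s)"
    using packing_count[OF _ P(1)] by (simp flip: of_nat_mult of_nat_add)
  ultimately have W: "waste P = uncovered_share s q K"
    by (simp add: waste_def uncovered_share_def P(2) field_simps)
  define h where "h = (q choose s)"
  define w where "w = waste P ^ h"
  \<comment> \<open>the factor that turns both sides of \<open>pack_product\<close> into densities\<close>
  define T where "T = fact s / (real K * real M) ^ q"
  have T0: "T \<ge> 0" by (simp add: T_def)
  have split: "x ^ q = x ^ s * x ^ (q - s)" for x :: real
    using sq by (simp flip: power_add)
  have "(real (M ^ s * card P) * (h * real (K * M) ^ (q - s))
       + (K choose q) * w * (real M ^ q - h * q * real M ^ (q - 1))) * T
     \<le> (real (pack s q (K * M)) * (h * real (K * M) ^ (q - s))) * T"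
    using pack_product[OF sq qK P(1)] T0 by (intro mult_right_mono) (simp_all add: h_def w_def)
  also have "(real (pack s q (K * M)) * (h * real (K * M) ^ (q - s))) * T = density s q (K * M)"
    using Kpos Mpos by (simp add: T_def density_def h_def split[of "real K * real M"])
  also have "(real (M ^ s * card P) * (h * real (K * M) ^ (q - s))
       + (K choose q) * w * (real M ^ q - h * q * real M ^ (q - 1))) * T
     = density s q K + fact s * (K choose q) / real K ^ q * w * (1 - h * q / M)"
  proof -
    have "real (M ^ s * card P) * (h * real (K * M) ^ (q - s)) * T = density s q K"
      using Kpos Mpos by (simp add: T_def density_def h_def split[of "real K"] split[of "real M"] P(2)
            power_mult_distrib)
    moreover have "(real M ^ q - h * q * real M ^ (q - 1)) * T = fact s / real K ^ q * (1 - h * q / M)"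
      using Kpos Mpos q0 by (cases q) (simp_all add: T_def power_mult_distrib field_simps)
    moreover have "(a + b * u * d) * T = a * T + b * u * (d * T)" for a b u d :: real
      by (simp add: algebra_simps)
    ultimately show ?thesis by simp
  qed
  finally show ?thesis by (simp add: w_def h_def W)
qed

end

text \<open>
  Moduli that are admissible for \<open>K\<close> occur in an arithmetic progression, hence with bounded gaps.
\<close>
lemma polynomial_code_fact: "0 < s \<Longrightarrow> polynomial_code (1 + j * fact K) K s"
proof
  fix d :: nat assume d: "0 < d" "d < K"
  then have "d dvd fact K" by (simp add: dvd_fact)
  then show "coprime d (1 + j * fact K)"
    by (metis coprime_1_right coprime_add_one_right coprime_mult_right_iff dvd_mult coprime_divisors dvd_refl add.commute)
qed auto

lemma uncovered_share_nonneg: "0 \<le> uncovered_share s q n"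
proof -
  have "real ((q choose s) * pack s q n) \<le> real (n choose s)"
    using pack_le_binomial of_nat_le_iff by blast
  then show ?thesis by (cases "n choose s = 0") (auto simp: uncovered_share_def divide_le_eq_1)
qed

text \<open>
  The density gained in the limit when a largest packing of \<open>K\<close> points is amplified.
\<close>
definition gain :: "nat \<Rightarrow> nat \<Rightarrow> nat \<Rightarrow> real" where
  "gain s q K = fact s * (K choose q) / real K ^ q * uncovered_share s q K ^ (q choose s)"

lemma gain_nonneg: "0 \<le> gain s q K"
  by (simp add: gain_def uncovered_share_nonneg)

text \<open>
  The amplified packing of \<open>K * M n\<close> points, regarded as a packing of \<open>n\<close> points, bounds the lower
  limit of the density from below. The sequence \<open>b\<close> takes the place of a statement about
  \<open>liminf\<close>.
\<close>
lemma density_lower: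
  assumes s: "0 < s" and sq: "s \<le> q" and qK: "q \<le> K"
  obtains b where "b \<longlonglongrightarrow> density s q K + gain s q K"
    "\<forall>\<^sub>F n in sequentially. b n \<le> density s q n"
proof -
  define D where "D = K * fact K"
  \<comment> \<open>the largest modulus in the progression for which the \<open>K * M n\<close> points fit into \<open>n\<close>\<close>
  define M where "M n = 1 + (n - K) div D * fact K" for n
  define h where "h = (q choose s) * q"
  have K0: "0 < K" using assms by simp
  have D0: "0 < D" using K0 by (simp add: D_def)
  have M: "K * M n \<le> n" "n < K * M n + D" if "K \<le> n" for n
  proof -
    have "K * M n = K + (n - K) div D * D" by (simp add: M_def D_def algebra_simps)
    moreover have "(n - K) div D * D \<le> n - K" by simp
    moreover have "n - K < (n - K) div D * D + D"
      using mod_less_divisor[OF D0, of "n - K"] div_mult_mod_eq[of "n - K" D] by linarith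
    ultimately show "K * M n \<le> n" "n < K * M n + D" using that by linarith+
  qed
  have ge: "\<forall>\<^sub>F n in sequentially. K \<le> n" by (rule eventually_ge_at_top)
  have M_top: "filterlim (\<lambda>n. real (M n)) at_top sequentially"
  proof (rule filterlim_at_top_mono)
    show "filterlim (\<lambda>n. real n / K - D / K) at_top sequentially"
      using K0 by real_asymp
    show "\<forall>\<^sub>F n in sequentially. real n / K - D / K \<le> real (M n)"
      using ge
    proof eventually_elim
      case (elim n)
      have "real n < real (K * M n + D)" using M(2)[OF elim] by (simp only: of_nat_less_iff)
      then show ?case using K0 by (simp add: field_simps)
    qed
  qed
  have ratio: "(\<lambda>n. real (K * M n) / real n) \<longlonglongrightarrow> 1"
  proof (rule tendsto_sandwich)
    show "(\<lambda>n. 1 - real D / real n) \<longlonglongrightarrow> 1" by real_asymp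
    show "\<forall>\<^sub>F n in sequentially. 1 - real D / real n \<le> real (K * M n) / real n"
      using ge
    proof eventually_elim
      case (elim n)
      have "real n < real (K * M n + D)" using M(2)[OF elim] by (simp only: of_nat_less_iff)
      then have "(real n - real D) / real n \<le> real (K * M n) / real n"
        by (intro divide_right_mono) simp_all
      then show ?case using K0 elim by (simp add: diff_divide_distrib)
    qed
    show "\<forall>\<^sub>F n in sequentially. real (K * M n) / real n \<le> 1"
      using ge
    proof eventually_elim
      case (elim n)
      have "real (K * M n) \<le> real n" using M(1)[OF elim] by (simp only: of_nat_le_iff)
      then show ?case using K0 elim by (simp add: divide_le_eq_1)
    qed
  qed simp
  let ?b = "\<lambda>n. (density s q K + gain s q K * (1 - h / real (M n))) * (real (K * M n) / real n) ^ s"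
  have "(\<lambda>n. h / real (M n)) \<longlonglongrightarrow> 0"
    by (rule real_tendsto_divide_at_top[OF tendsto_const M_top])
  then have "?b \<longlonglongrightarrow> (density s q K + gain s q K * (1 - 0)) * 1 ^ s"
    by (intro tendsto_intros ratio)
  moreover have "\<forall>\<^sub>F n in sequentially. ?b n \<le> density s q n"
    using ge
  proof eventually_elim
    case (elim n)
    interpret polynomial_code "M n" K s
      unfolding M_def by (rule polynomial_code_fact[OF s])
    have n0: "0 < n" using K0 elim by simp
    have KM0: "0 < K * M n" using K0 M_pos by simp
    have "density s q K + gain s q K * (1 - h / real (M n)) \<le> density s q (K * M n)"
      using density_product[OF sq qK] by (simp add: gain_def h_def)
    then have "?b n \<le> density s q (K * M n) * (real (K * M n) / real n) ^ s"
      by (intro mult_right_mono) simp_all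
    also have "\<dots> = (q choose s) * fact s * pack s q (K * M n) / real n ^ s"
      using KM0 n0 by (simp add: density_def power_divide del: of_nat_mult)
    also have "\<dots> \<le> density s q n"
      unfolding density_def using pack_mono[OF M(1)[OF elim], of s q]
      by (intro divide_right_mono mult_left_mono of_nat_mono) simp_all
    finally show ?case .
  qed
  ultimately show ?thesis by (intro that[of ?b]) simp_all
qed

text \<open>
  Without the gain, the previous lemma says that the lower limit of the density is at least its
  value at each \<open>K \<ge> q\<close>, so the density converges to its supremum \<open>L\<close> over these \<open>K\<close>. With the
  gain, \<open>L\<close> would be exceeded if \<open>L < 1\<close>, because the uncovered share tends to \<open>1 - L\<close>.
\<close>
lemma density_tendsto_1:
  assumes s: "0 < s" and sq: "s \<le> q"
  shows "density s q \<longlonglongrightarrow> 1"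
proof -
  have q0: "0 < q" using s sq by simp
  define L where "L = (SUP K\<in>{q..}. density s q K)"
  have bdd: "bdd_above (density s q ` {q..})"
    using density_le_1 by (intro bdd_aboveI2)
  have upper: "density s q n \<le> L" if "q \<le> n" for n
    unfolding L_def by (rule cSUP_upper[OF _ bdd]) (use that in simp)
  have lim: "density s q \<longlonglongrightarrow> L"
  proof (rule order_tendstoI)
    fix a assume "a < L"
    then obtain K where K: "q \<le> K" "a < density s q K"
      unfolding L_def using less_cSUP_iff[OF _ bdd] by auto
    obtain b where b: "b \<longlonglongrightarrow> density s q K + gain s q K"
      "\<forall>\<^sub>F n in sequentially. b n \<le> density s q n" by (rule density_lower[OF s sq K(1)])
    have "a < density s q K + gain s q K" using K(2) gain_nonneg[of s q K] by linarith
    from order_tendstoD(1)[OF b(1) this] b(2)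
    show "\<forall>\<^sub>F n in sequentially. a < density s q n" by eventually_elim simp
  next
    fix a assume a: "L < a"
    show "\<forall>\<^sub>F n in sequentially. density s q n < a"
      by (rule eventually_mono[OF eventually_ge_at_top[of q]]) (use upper a le_less_trans in blast)
  qed
  have "L \<le> 1" using lim density_le_1 by (intro LIMSEQ_le_const2) auto
  \<comment> \<open>a lower bound, independent of \<open>K\<close>, for the coefficient in \<open>gain\<close>\<close>
  define c where "c = fact s / real q ^ q"
  have c0: "c > 0" using q0 by (simp add: c_def)
  have step: "density s q K + c * uncovered_share s q K ^ (q choose s) \<le> L" if K: "q \<le> K" for K
  proof -
    obtain b where b: "b \<longlonglongrightarrow> density s q K + gain s q K"
      "\<forall>\<^sub>F n in sequentially. b n \<le> density s q n" by (rule density_lower[OF s sq K])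
    have "density s q K + gain s q K \<le> L"
      by (rule tendsto_le[OF trivial_limit_sequentially lim b])
    moreover have "c \<le> fact s * (K choose q) / real K ^ q"
    proof -
      have "(real K / real q) ^ q \<le> real (K choose q)"
        using binomial_ge_n_over_k_pow_k[OF K, where 'a = real] by simp
      then show ?thesis using K q0 by (simp add: c_def field_simps)
    qed
    then have "c * uncovered_share s q K ^ (q choose s) \<le> gain s q K"
      unfolding gain_def by (intro mult_right_mono zero_le_power uncovered_share_nonneg)
    ultimately show ?thesis by simp
  qed
  have share: "uncovered_share s q \<longlonglongrightarrow> 1 - L / 1"
  proof (rule Lim_transform_eventually)
    show "(\<lambda>n. 1 - density s q n / ((n choose s) * fact s / real n ^ s)) \<longlonglongrightarrow> 1 - L / 1"
      by (intro tendsto_intros lim binomial_asymp) simp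
    show "\<forall>\<^sub>F n in sequentially. 1 - density s q n / ((n choose s) * fact s / real n ^ s) = uncovered_share s q n"
      using eventually_ge_at_top[of q] by eventually_elim (use uncovered_share_eq q0 sq in simp)
  qed
  have "(\<lambda>n. density s q n + c * uncovered_share s q n ^ (q choose s)) \<longlonglongrightarrow> L + c * (1 - L / 1) ^ (q choose s)"
    by (intro tendsto_intros lim share)
  then have "L + c * (1 - L / 1) ^ (q choose s) \<le> L"
    by (rule LIMSEQ_le_const2) (use step in blast)
  then have "(1 - L) ^ (q choose s) \<le> 0" using c0 by (simp add: mult_le_0_iff)
  then have "L = 1" using \<open>L \<le> 1\<close> zero_less_power[of "1 - L" "q choose s"] by fastforce
  then show ?thesis using lim by simp
qed

lemma uncovered_share_tendsto_0:
  assumes s: "0 < s" and sq: "s \<le> q"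
  shows "uncovered_share s q \<longlonglongrightarrow> 0"
proof (rule Lim_transform_eventually)
  have "(\<lambda>n. 1 - density s q n / ((n choose s) * fact s / real n ^ s)) \<longlonglongrightarrow> 1 - 1 / 1"
    by (intro tendsto_intros density_tendsto_1 assms binomial_asymp) simp
  then show "(\<lambda>n. 1 - density s q n / ((n choose s) * fact s / real n ^ s)) \<longlonglongrightarrow> 0" by simp
  show "\<forall>\<^sub>F n in sequentially. 1 - density s q n / ((n choose s) * fact s / real n ^ s) = uncovered_share s q n"
    using eventually_ge_at_top[of q] by eventually_elim (use uncovered_share_eq s sq in simp)
qed

text \<open>
  A covering design: every \<open>s\<close>-subset of \<open>V\<close> lies in a block of size \<open>q\<close>.
\<close>
definition covering :: "nat \<Rightarrow> nat \<Rightarrow> 'a set \<Rightarrow> 'a set set \<Rightarrow> bool" where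
  "covering s q V C \<longleftrightarrow> C \<subseteq> nsets V q \<and> (\<forall>S\<in>nsets V s. \<exists>B\<in>C. S \<subseteq> B)"

text \<open>
  A largest packing together with one further block for each uncovered \<open>s\<close>-set.
\<close>
lemma covering_exists:
  assumes V: "finite V" and sq: "s \<le> q" and qV: "q \<le> card V"
  obtains C where "covering s q V C"
    "card C + (q choose s) * pack s q (card V) \<le> pack s q (card V) + (card V choose s)"
proof -
  obtain P where P: "packing s q V P" "card P = pack s q (card V)"
    by (rule packing_on_attained[OF V])
  have finP: "finite P" using packing_finite V P by blast
  have ext: "\<exists>B. B \<in> nsets V q \<and> S \<subseteq> B" if S: "S \<in> nsets V s" for S
  proof -
    have S': "S \<subseteq> V" "finite S" "card S = s" using S by (auto simp: nsets_def)
    have "q - s \<le> card (V - S)" using S' qV by (simp add: card_Diff_subset)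
    then obtain T where T: "T \<subseteq> V - S" "card T = q - s" "finite T"
      by (rule obtain_subset_with_card_n)
    then have "card (S \<union> T) = q" using S' sq by (subst card_Un_disjoint) auto
    then show ?thesis using T S' by (intro exI[of _ "S \<union> T"]) (auto simp: nsets_def)
  qed
  obtain e where e: "\<And>S. S \<in> nsets V s \<Longrightarrow> e S \<in> nsets V q \<and> S \<subseteq> e S"
    using ext by metis
  let ?U = "uncovered s V P"
  have U: "?U \<subseteq> nsets V s" "finite ?U"
    using finite_imp_finite_nsets[OF V, of s] by (auto simp: uncovered_def)
  show ?thesis
  proof (rule that)
    show "covering s q V (P \<union> e ` ?U)"
      unfolding covering_def
    proof (intro conjI ballI)
      show "P \<union> e ` ?U \<subseteq> nsets V q" using P(1) e U(1) by (auto simp: packing_def)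
      fix S assume S: "S \<in> nsets V s"
      show "\<exists>B\<in>P \<union> e ` ?U. S \<subseteq> B"
      proof (cases "S \<in> ?U")
        case True
        then show ?thesis using e[OF S] by blast
      next
        case False
        then show ?thesis using S by (auto simp: uncovered_def)
      qed
    qed
    have "card (P \<union> e ` ?U) \<le> card P + card ?U"
      using card_Un_le[of P "e ` ?U"] card_image_le[OF U(2), of e] by linarith
    then show "card (P \<union> e ` ?U) + (q choose s) * pack s q (card V) \<le> pack s q (card V) + (card V choose s)"
      using packing_count[OF V P(1)] P(2) by simp
  qed
qed

text \<open>
  Asymptotically optimal covering designs (the conjecture of Erdos and Hanani, a theorem of Rodl).
\<close>
theorem asymptotic_covering:
  assumes s: "0 < s" and sq: "s \<le> q"
  obtains \<delta> :: "nat \<Rightarrow> real" where "\<delta> \<longlonglongrightarrow> 0"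
    "\<And>V :: 'a set. finite V \<Longrightarrow> q \<le> card V \<Longrightarrow> \<exists>C. covering s q V C \<and>
       real (card C) \<le> (1 + \<delta> (card V)) * ((card V choose s) / (q choose s))"
proof (rule that)
  let ?\<delta> = "\<lambda>n. real (q choose s) * uncovered_share s q n"
  have "?\<delta> \<longlonglongrightarrow> real (q choose s) * 0"
    by (intro tendsto_intros uncovered_share_tendsto_0 assms)
  then show "?\<delta> \<longlonglongrightarrow> 0" by simp
  fix V :: "'a set" assume V: "finite V" "q \<le> card V"
  define n where "n = card V"
  define h where "h = (q choose s)"
  have h: "real h > 0" using sq by (simp add: h_def)
  have N: "real (n choose s) > 0" using V sq by (simp add: n_def)
  obtain C where C: "covering s q V C" "card C + h * pack s q n \<le> pack s q n + (n choose s)"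
    using covering_exists[OF V(1) sq V(2)] unfolding n_def h_def by blast
  have "real (card C + h * pack s q n) \<le> real (pack s q n + (n choose s))"
    using C(2) by (simp only: of_nat_le_iff)
  moreover have le: "real (h * pack s q n) \<le> real (n choose s)"
    using pack_le_binomial unfolding h_def by (simp only: of_nat_le_iff)
  then have "real (pack s q n) \<le> real (n choose s) / h" using h by (simp add: field_simps)
  ultimately have "real (card C) \<le> (n choose s) / h + (real (n choose s) - real h * pack s q n)" by simp
  also have "\<dots> = (1 + h * uncovered_share s q n) * ((n choose s) / h)"
    using h N by (simp add: uncovered_share_def h_def[symmetric] field_simps)
  finally show "\<exists>C. covering s q V C \<and> real (card C) \<le> (1 + ?\<delta> (card V)) * ((card V choose s) / (q choose s))"
    using C(1) by (auto simp: n_def h_def)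
qed

section \<open>Arcs through given vertices of a cycle\<close>

text \<open>
  Disjoint intervals of prescribed lengths that cover a set \<open>P\<close> of at most as many points: each
  interval starts at the first point not covered yet, or directly after the previous one if no such
  point is left. Disjointness is expressed by the cardinality of the union.
\<close>
lemma disjoint_intervals:
  fixes ls :: "nat list" and P :: "nat set"
  assumes "card P \<le> length ls" "\<forall>l\<in>set ls. 0 < l" "P \<subseteq> {b..<e}" "b \<le> e"
  shows "\<exists>u. P \<subseteq> (\<Union>i<length ls. {u i..<u i + ls ! i}) \<and>
    (\<Union>i<length ls. {u i..<u i + ls ! i}) \<subseteq> {b..<e + sum_list ls} \<and>
    card (\<Union>i<length ls. {u i..<u i + ls ! i}) = sum_list ls"
  using assms
proof (induction ls arbitrary: P b e)
  case Nil
  then have "finite P" "card P = 0" using finite_subset by auto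
  then show ?case by simp
next
  case (Cons l ls)
  have finP: "finite P" using Cons.prems finite_subset by blast
  define p where "p = (if P = {} then b else Min P)"
  have pP: "p \<in> P" if "P \<noteq> {}" using that finP by (simp add: p_def)
  have p: "b \<le> p \<and> p \<le> e"
  proof (cases "P = {}")
    case True
    then show ?thesis using Cons.prems by (simp add: p_def)
  next
    case False
    then have "p \<in> {b..<e}" using pP Cons.prems by blast
    then show ?thesis by simp
  qed
  have ge: "p \<le> y" if "y \<in> P" for y using that finP by (auto simp: p_def)
  define P' where "P' = P - {..<p + l}"
  have l: "0 < l" using Cons.prems by simp
  have "card P' \<le> length ls"
  proof (cases "P = {}")
    case False
    have "P' \<subseteq> P" "p \<notin> P'" using l by (auto simp: P'_def)
    then have "P' \<subset> P" using pP[OF False] by blast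
    then have "card P' < card P" by (rule psubset_card_mono[OF finP])
    then show ?thesis using Cons.prems by simp
  qed (simp add: P'_def)
  moreover have "P' \<subseteq> {p + l..<e + l}" using Cons.prems by (auto simp: P'_def)
  moreover have "p + l \<le> e + l" using p by simp
  ultimately obtain u where u: "P' \<subseteq> (\<Union>i<length ls. {u i..<u i + ls ! i})"
    "(\<Union>i<length ls. {u i..<u i + ls ! i}) \<subseteq> {p + l..<e + l + sum_list ls}"
    "card (\<Union>i<length ls. {u i..<u i + ls ! i}) = sum_list ls"
    using Cons.IH[of P' "p + l" "e + l"] Cons.prems by auto
  let ?U = "\<Union>i<length ls. {u i..<u i + ls ! i}"
  define v where "v = case_nat p u"
  have eq: "(\<Union>i<length (l # ls). {v i..<v i + (l # ls) ! i}) = {p..<p + l} \<union> ?U"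
    by (simp add: v_def lessThan_Suc_eq_insert_0)
  have "P \<subseteq> {p..<p + l} \<union> ?U"
  proof
    fix y assume y: "y \<in> P"
    show "y \<in> {p..<p + l} \<union> ?U"
    proof (cases "y < p + l")
      case True
      then show ?thesis using ge[OF y] by simp
    next
      case False
      then have "y \<in> P'" using y by (simp add: P'_def)
      then show ?thesis using u(1) by blast
    qed
  qed
  moreover have "{p..<p + l} \<union> ?U \<subseteq> {b..<e + sum_list (l # ls)}"
  proof
    fix y assume "y \<in> {p..<p + l} \<union> ?U"
    then have "y \<in> {p..<p + l} \<or> y \<in> {p + l..<e + l + sum_list ls}" using u(2) by blast
    then show "y \<in> {b..<e + sum_list (l # ls)}" using p by auto
  qed
  moreover have "card ({p..<p + l} \<union> ?U) = sum_list (l # ls)"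
  proof -
    have "{p..<p + l} \<inter> ?U \<subseteq> {p..<p + l} \<inter> {p + l..<e + l + sum_list ls}" using u(2) by blast
    also have "\<dots> = {}" by auto
    finally have "{p..<p + l} \<inter> ?U = {}" by blast
    then show ?thesis using u(3) by (subst card_Un_disjoint) auto
  qed
  ultimately show ?case unfolding eq[symmetric] by blast
qed

lemma bij_mod_window: "bij_betw (\<lambda>p. p mod n) {z..<z + n} {..<n::nat}"
proof -
  have inj: "inj_on (\<lambda>p. p mod n) {z..<z + n}"
  proof (rule linorder_inj_onI)
    fix a b assume "a < b" "a \<in> {z..<z + n}" "b \<in> {z..<z + n}"
    then have ab: "0 < b - a" "b - a < n" "a \<le> b" by auto
    show "a mod n \<noteq> b mod n"
    proof
      assume "a mod n = b mod n"
      then have "n dvd b - a" using mod_eq_dvd_iff_nat[OF ab(3), of n] by simp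
      then show False using ab nat_dvd_not_less by blast
    qed
  qed auto
  moreover have "(\<lambda>p. p mod n) ` {z..<z + n} = {..<n}"
  proof (rule card_subset_eq)
    show "(\<lambda>p. p mod n) ` {z..<z + n} \<subseteq> {..<n}" by auto
    show "card ((\<lambda>p. p mod n) ` {z..<z + n}) = card {..<n}" using card_image[OF inj] by simp
  qed simp
  ultimately show ?thesis by (simp add: bij_betw_def)
qed

lemma arc_interval:
  assumes "0 < u"
  shows "arc n c (u - 1) l = (\<lambda>p. c (p mod n)) ` {u..<u + l}"
proof -
  have eq: "{u..<u + l} = (\<lambda>j. u - 1 + j) ` {1..l}"
  proof (intro equalityI subsetI)
    fix y assume "y \<in> {u..<u + l}"
    then show "y \<in> (\<lambda>j. u - 1 + j) ` {1..l}"
      using assms by (intro image_eqI[of _ _ "y - (u - 1)"]) auto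
  qed (use assms in auto)
  then show ?thesis by (simp only: arc_def eq image_image)
qed

text \<open>
  The same on a long cycle, which has a stretch of \<open>sum_list ls\<close> positions without elements of \<open>T\<close>
  and can be cut open behind it.
\<close>
lemma arcs_through:
  assumes c: "hamilton_cycle n c" and T: "T \<subseteq> {1..n}" "card T \<le> length ls"
    and ls: "\<forall>l\<in>set ls. 0 < l" and pos: "0 < sum_list ls"
    and n: "(card T + 1) * sum_list ls \<le> n"
  obtains a where "T \<subseteq> (\<Union>i<length ls. arc n c (a i) (ls ! i))"
    "(\<Union>i<length ls. arc n c (a i) (ls ! i)) \<subseteq> {1..n}"
    "card (\<Union>i<length ls. arc n c (a i) (ls ! i)) = sum_list ls"
proof -
  define R where "R = sum_list ls"
  have R0: "0 < R" using pos by (simp add: R_def)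
  have finT: "finite T" using T finite_subset by blast
  have cbij: "bij_betw c {..<n} {1..n}" using c by (simp add: hamilton_cycle_def)
  define Q where "Q = {p \<in> {..<n}. c p \<in> T}"
  have "inj_on c Q" using cbij by (auto simp: bij_betw_def Q_def intro: inj_on_subset)
  moreover have "c ` Q \<subseteq> T" by (auto simp: Q_def)
  ultimately have "card Q \<le> card T" using finT by (rule card_inj_on_le)
  moreover have "card ((\<lambda>p. p div R) ` Q) \<le> card Q" by (rule card_image_le) (simp add: Q_def)
  ultimately have "\<not> {..card T} \<subseteq> (\<lambda>p. p div R) ` Q"
    using card_mono[of "(\<lambda>p. p div R) ` Q" "{..card T}"] by (auto simp: Q_def)
  \<comment> \<open>one of the first \<open>card T + 1\<close> stretches of length \<open>R\<close> contains no element of \<open>T\<close>\<close>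
  then obtain j where j: "j \<le> card T" "\<And>p. p \<in> Q \<Longrightarrow> p div R \<noteq> j" by fastforce
  define z where "z = (j + 1) * R"
  have "z \<le> (card T + 1) * R" unfolding z_def using j(1) by (intro mult_le_mono1) simp
  then have zn: "z \<le> n" using n by (simp add: R_def)
  have zR: "R \<le> z" by (simp add: z_def)
  define d where "d = (\<lambda>p. c (p mod n))"
  have dbij: "bij_betw d {z..<z + n} {1..n}"
    using bij_betw_trans[OF bij_mod_window cbij] by (simp add: d_def comp_def)
  define P where "P = {p \<in> {z..<z + n}. d p \<in> T}"
  have dinj: "inj_on d {z..<z + n}" using dbij by (simp add: bij_betw_def)
  have "inj_on d P" using dinj by (rule inj_on_subset) (auto simp: P_def)
  moreover have "d ` P \<subseteq> T" by (auto simp: P_def)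
  ultimately have "card P \<le> card T" using finT by (rule card_inj_on_le)
  then have cardP: "card P \<le> length ls" using T by simp
  have sub: "P \<subseteq> {z..<z + n - R}"
  proof
    fix p assume p: "p \<in> P"
    have "\<not> z + n - R \<le> p"
    proof
      assume *: "z + n - R \<le> p"
      have "n \<le> p" "p - n < n" using * zR p zn by (auto simp: P_def)
      then have pm: "p mod n = p - n" by (simp add: le_mod_geq)
      have "j * R \<le> p - n" "p - n < (j + 1) * R"
        using * p zR by (auto simp: P_def z_def)
      then have "(p - n) div R = j" by (simp add: div_nat_eqI mult.commute)
      moreover have "p mod n \<in> Q" using p pm \<open>p - n < n\<close> by (auto simp: Q_def P_def d_def)
      ultimately show False using j(2) pm by auto
    qed
    then show "p \<in> {z..<z + n - R}" using p by (auto simp: P_def)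
  qed
  have zb: "z \<le> z + n - R" using zR zn by linarith
  obtain u where u: "P \<subseteq> (\<Union>i<length ls. {u i..<u i + ls ! i})"
    "(\<Union>i<length ls. {u i..<u i + ls ! i}) \<subseteq> {z..<z + n - R + sum_list ls}"
    "card (\<Union>i<length ls. {u i..<u i + ls ! i}) = sum_list ls"
    using disjoint_intervals[OF cardP ls sub zb] by blast
  let ?U = "\<Union>i<length ls. {u i..<u i + ls ! i}"
  have U: "?U \<subseteq> {z..<z + n}" using u(2) zR by (simp add: R_def)
  have arcs: "arc n c (u i - 1) (ls ! i) = d ` {u i..<u i + ls ! i}" if "i < length ls" for i
    unfolding d_def
  proof (rule arc_interval)
    have "0 < ls ! i" using ls that by simp
    then have "u i \<in> ?U" using that by auto
    then have "z \<le> u i" using subsetD[OF U, of "u i"] by simp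
    then show "0 < u i" using zR R0 by linarith
  qed
  have eq: "(\<Union>i<length ls. arc n c (u i - 1) (ls ! i)) = d ` ?U"
    using arcs by (simp add: image_UN)
  have im: "d ` {z..<z + n} = {1..n}" using dbij by (simp add: bij_betw_def)
  show ?thesis
  proof (rule that[of "\<lambda>i. u i - 1"], unfold eq)
    show "T \<subseteq> d ` ?U"
    proof
      fix y assume y: "y \<in> T"
      then have "y \<in> d ` {z..<z + n}" unfolding im using T(1) by blast
      then obtain p where "p \<in> {z..<z + n}" "d p = y" by blast
      then have "p \<in> P" using y by (simp add: P_def)
      then show "y \<in> d ` ?U" using u(1) \<open>d p = y\<close> by blast
    qed
    show "d ` ?U \<subseteq> {1..n}" using image_mono[OF U, of d] unfolding im .
    show "card (d ` ?U) = sum_list ls"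
      using card_image[OF inj_on_subset[OF dinj U]] u(3) by simp
  qed
qed

lemma m_le_card:
  assumes "F \<subseteq> nsets {1..n} (sum_list x)" "\<And>c. hamilton_cycle n c \<Longrightarrow> \<not> acceptable x n F c"
  shows "m x n \<le> card F"
proof -
  let ?\<F> = "{F. F \<subseteq> nsets {1..n} (sum_list x) \<and> \<not> (\<exists>c. hamilton_cycle n c \<and> acceptable x n F c)}"
  have "finite ?\<F>"
    by (rule finite_subset[of _ "Pow (nsets {1..n} (sum_list x))"]) (auto simp: finite_imp_finite_nsets)
  then show ?thesis unfolding m_def using assms by (intro Min_le) auto
qed

text \<open>
  Adding \<open>{1..t}\<close> to the blocks of a covering design on the other vertices gives a family without
  acceptable Hamilton cycle. The \<open>t\<close> long arcs are placed disjointly through \<open>1, ..., t\<close>; the other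
  \<open>r - k\<close> vertices on them lie in a common block, and the arcs of length \<open>1\<close> pick up the \<open>k - t\<close>
  remaining elements of this block.
\<close>
lemma m_le_covering:
  fixes x :: "nat list" and t n :: nat
  assumes pos: "\<forall>y\<in>set x. y > 0" and t: "1 \<le> t" "t < length x"
    and one: "\<forall>i\<in>{t..<length x}. x ! i = 1"
    and n: "(t + 1) * sum_list x \<le> n"
    and C: "covering (sum_list x - length x) (sum_list x - t) {t + 1..n} C"
  shows "m x n \<le> card C"
proof -
  define k where "k = length x"
  define r where "r = sum_list x"
  define ls where "ls = take t x"
  have lenls: "length ls = t" using t by (simp add: ls_def)
  have lspos: "\<forall>l\<in>set ls. 0 < l" using pos by (auto simp: ls_def dest: in_set_takeD)
  have "drop t x = replicate (k - t) 1"
    using one by (intro nth_equalityI) (auto simp: k_def)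
  then have "sum_list (take t x @ drop t x) = sum_list ls + (k - t)"
    by (simp only: sum_list_append ls_def sum_list_replicate) simp
  then have "r = sum_list ls + (k - t)" by (simp add: r_def)
  then have R: "sum_list ls + (k - t) = r" by simp
  have "t \<le> sum_list ls"
  proof -
    have "(\<Sum>l\<leftarrow>ls. 1) \<le> sum_list (map id ls)" by (rule sum_list_mono) (use lspos in force)
    then show ?thesis using lenls by (simp add: sum_list_triv)
  qed
  then have kr: "k \<le> r" using R t by (simp add: k_def)
  have tn: "t \<le> n" using n \<open>t \<le> sum_list ls\<close> R t unfolding r_def[symmetric]
    by (metis add_leD1 dual_order.trans le_add2 mult_Suc Suc_eq_plus1)
  define F where "F = (\<lambda>B. {1..t} \<union> B) ` C"
  have CB: "B \<subseteq> {t + 1..n}" "finite B" "card B = r - t" if "B \<in> C" for B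
    using C that by (auto simp: covering_def nsets_def r_def)
  have "F \<subseteq> nsets {1..n} (sum_list x)"
  proof
    fix A assume "A \<in> F"
    then obtain B where B: "B \<in> C" "A = {1..t} \<union> B" by (auto simp: F_def)
    have "{1..t} \<inter> B = {}" using CB(1)[OF B(1)] by auto
    then have "card A = r"
      using CB[OF B(1)] B(2) kr t by (simp add: card_Un_disjoint k_def)
    then show "A \<in> nsets {1..n} (sum_list x)"
      using CB[OF B(1)] B(2) tn by (auto simp: nsets_def r_def)
  qed
  moreover have "\<not> acceptable x n F c" if c: "hamilton_cycle n c" for c
  proof -
    have "sum_list ls \<le> r" using R by simp
    then have "(t + 1) * sum_list ls \<le> (t + 1) * r" by (rule mult_le_mono2)
    then have n': "(card {1..t} + 1) * sum_list ls \<le> n" using n by (simp add: r_def)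
    obtain a where a: "{1..t} \<subseteq> (\<Union>i<length ls. arc n c (a i) (ls ! i))"
      "(\<Union>i<length ls. arc n c (a i) (ls ! i)) \<subseteq> {1..n}"
      "card (\<Union>i<length ls. arc n c (a i) (ls ! i)) = sum_list ls"
      by (rule arcs_through[OF c _ _ lspos _ n']) (use tn lenls t \<open>t \<le> sum_list ls\<close> in auto)
    define A where "A = (\<Union>i<t. arc n c (a i) (x ! i))"
    have "(\<Union>i<length ls. arc n c (a i) (ls ! i)) = A"
      unfolding A_def lenls by (simp add: ls_def)
    then have A: "{1..t} \<subseteq> A" "A \<subseteq> {1..n}" "card A = sum_list ls" using a by simp_all
    have finA: "finite A" using A(2) finite_subset by blast
    have "card (A - {1..t}) = r - k" using A R t by (simp add: card_Diff_subset k_def)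
    moreover have "A - {1..t} \<subseteq> {t + 1..n}" using A(2) by auto
    ultimately have "A - {1..t} \<in> nsets {t + 1..n} (sum_list x - length x)"
      using finA by (simp add: nsets_def r_def k_def)
    then obtain B where B: "B \<in> C" "A - {1..t} \<subseteq> B" using C unfolding covering_def by blast
    have "B - A = B - (A - {1..t})" using CB(1)[OF B(1)] by auto
    then have "card (B - A) = card B - card (A - {1..t})"
      using B(2) finA by (simp add: card_Diff_subset)
    also have "\<dots> = k - t" using CB(3)[OF B(1)] \<open>card (A - {1..t}) = r - k\<close> kr t by (simp add: k_def)
    finally have "card (B - A) = k - t" .
    then obtain w where w: "bij_betw w {..<k - t} (B - A)"
      using ex_bij_betw_nat_finite[of "B - A"] CB(2)[OF B(1)] by (auto simp: atLeast0LessThan)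
    have n0: "0 < n" using tn t by simp
    define g where "g = inv_into {..<n} c"
    have g: "c (g y) = y" "g y < n" if "y \<in> {1..n}" for y
      using c that bij_betw_inv_into_right[of c "{..<n}" "{1..n}" y] inv_into_into[of y c "{..<n}"]
      by (auto simp: hamilton_cycle_def g_def bij_betw_def)
    \<comment> \<open>an arc starts one position after its parameter; adding \<open>n\<close> keeps the parameter a natural number\<close>
    define s where "s i = (if i < t then a i else g (w (i - t)) + n - 1)" for i
    have single: "arc n c (s i) (x ! i) = {w (i - t)}" if i: "i \<in> {t..<k}" for i
    proof -
      have "w (i - t) \<in> B - A" using w i unfolding bij_betw_def by (metis atLeastLessThan_iff diff_less_mono imageI lessThan_iff)
      then have y: "w (i - t) \<in> {1..n}" using CB(1)[OF B(1)] by auto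
      have "x ! i = 1" using one i by (simp add: k_def)
      moreover have "(s i + 1) mod n = g (w (i - t))" using i n0 g(2)[OF y] by (simp add: s_def)
      ultimately show ?thesis using g(1)[OF y] by (simp add: arc_def)
    qed
    have "{..<length x} = {..<t} \<union> {t..<k}" using t by (auto simp: k_def)
    then have "(\<Union>i<length x. arc n c (s i) (x ! i))
        = (\<Union>i<t. arc n c (s i) (x ! i)) \<union> (\<Union>i\<in>{t..<k}. arc n c (s i) (x ! i))"
      by (simp add: UN_Un)
    also have "(\<Union>i<t. arc n c (s i) (x ! i)) = A" by (simp add: A_def s_def)
    also have "(\<Union>i\<in>{t..<k}. arc n c (s i) (x ! i)) = (\<Union>i\<in>{t..<k}. {w (i - t)})"
      using single by simp
    also have "\<dots> = w ` {..<k - t}"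
    proof -
      have "{..<k - t} = (\<lambda>i. i - t) ` {t..<k}"
        by (auto intro!: image_eqI[of _ _ "_ + t"])
      then show ?thesis by auto
    qed
    also have "\<dots> = B - A" using w by (simp add: bij_betw_def)
    also have "A \<union> (B - A) = {1..t} \<union> B" using A(1) B(2) by blast
    also have "\<dots> \<in> F" using B(1) by (simp add: F_def)
    finally show ?thesis unfolding acceptable_def by blast
  qed
  ultimately have "m x n \<le> card F" by (rule m_le_card)
  also have "finite C"
    using C finite_imp_finite_nsets[of "{t + 1..n}"] finite_subset unfolding covering_def by blast
  then have "card F \<le> card C" unfolding F_def by (rule card_image_le)
  finally show ?thesis .
qed

section \<open>The asymptotic bound\<close>

lemma binomial_shift_asymp:
  "(\<lambda>n. ((n - t) choose s) / real n ^ s) \<longlonglongrightarrow> 1 / fact s"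
proof (rule Lim_transform_eventually)
  have "(\<lambda>n. real ((n - t) choose s) * fact s / real (n - t) ^ s) \<longlonglongrightarrow> 1"
    using filterlim_compose[OF binomial_asymp[of s] filterlim_minus_const_nat_at_top[of t]] by simp
  moreover have "(\<lambda>n. real (n - t) / real n) \<longlonglongrightarrow> 1"
  proof (rule Lim_transform_eventually)
    show "(\<lambda>n. 1 - real t / real n) \<longlonglongrightarrow> 1" by real_asymp
    show "\<forall>\<^sub>F n in sequentially. 1 - real t / real n = real (n - t) / real n"
      using eventually_gt_at_top[of t] by eventually_elim (simp add: field_simps of_nat_diff)
  qed
  ultimately have "(\<lambda>n. real ((n - t) choose s) * fact s / real (n - t) ^ s * (real (n - t) / real n) ^ s / fact s)
      \<longlonglongrightarrow> 1 * 1 ^ s / fact s"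
    by (intro tendsto_intros) simp_all
  then show "(\<lambda>n. real ((n - t) choose s) * fact s / real (n - t) ^ s * (real (n - t) / real n) ^ s / fact s)
      \<longlonglongrightarrow> 1 / fact s" by simp
  show "\<forall>\<^sub>F n in sequentially. real ((n - t) choose s) * fact s / real (n - t) ^ s * (real (n - t) / real n) ^ s / fact s
      = ((n - t) choose s) / real n ^ s"
    using eventually_gt_at_top[of t]
    by eventually_elim (simp add: power_divide)
qed

theorem theorem16:
  fixes x :: "nat list" and k r t :: nat
  assumes "k = length x" and "r = sum_list x"
    and "\<forall>y\<in>set x. y > 0"
    and "1 \<le> t" and "t < k"
    and "sorted_wrt (\<ge>) (take t x)"
    and "x ! (t - 1) > x ! t"
    and "\<forall>i\<in>{t..<k}. x ! i = 1"
  shows "\<exists>e1 e2 :: nat \<Rightarrow> real.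
    e1 \<longlonglongrightarrow> 0 \<and> e2 \<longlonglongrightarrow> 0 \<and>
    (\<forall>n\<ge>r.
      real (m x n) \<le> (1 + e1 n) * (real ((n - t) choose (r - k)) / real ((r - t) choose (r - k))) \<and>
      (1 + e1 n) * (real ((n - t) choose (r - k)) / real ((r - t) choose (r - k)))
        = (fact (k - t) / fact (r - t) + e2 n) * real n ^ (r - k))"
proof -
  define s where "s = r - k"
  define q where "q = r - t"
  have kr: "k < r"
  proof -
    have "(\<Sum>i<k. 1) < (\<Sum>i<k. x ! i)"
    proof (rule sum_strict_mono_ex1)
      show "\<forall>i\<in>{..<k}. 1 \<le> x ! i" using assms(1,3) by (auto simp: Suc_le_eq)
      show "\<exists>i\<in>{..<k}. 1 < x ! i" using assms(4,5,7,8) by (intro bexI[of _ "t - 1"]) auto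
    qed simp
    also have "(\<Sum>i<k. x ! i) = r"
      unfolding assms(1,2) by (simp add: sum_list_sum_nth atLeast0LessThan)
    finally show ?thesis by simp
  qed
  have s: "0 < s" and sq: "s \<le> q" and qs: "q - s = k - t" using kr assms(5) by (auto simp: s_def q_def)
  obtain \<delta> where \<delta>: "\<delta> \<longlonglongrightarrow> 0" "\<And>V :: nat set. finite V \<Longrightarrow> q \<le> card V \<Longrightarrow> \<exists>C. covering s q V C \<and>
       real (card C) \<le> (1 + \<delta> (card V)) * ((card V choose s) / (q choose s))"
    using asymptotic_covering[OF s sq, where 'a = nat] by blast
  define b where "b n = real ((n - t) choose s) / real (q choose s)" for n
  have b0: "0 < b n" if "r \<le> n" for n
    using that kr assms(5) by (simp add: b_def s_def q_def)
  have upper: "real (m x n) \<le> (1 + \<delta> (n - t)) * b n" if n: "(t + 1) * r \<le> n" for n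
  proof -
    have rn: "r \<le> n" using n by simp
    have cd: "card {t + 1..n} = n - t" by simp
    have qn: "q \<le> n - t" using rn by (simp add: q_def)
    obtain C where C: "covering s q {t + 1..n} C"
      "real (card C) \<le> (1 + \<delta> (n - t)) * (((n - t) choose s) / (q choose s))"
      using \<delta>(2)[of "{t + 1..n}", unfolded cd, OF finite_atLeastAtMost qn] by blast
    have "m x n \<le> card C"
      by (rule m_le_covering[of x t]) (use assms n C(1) in \<open>simp_all add: s_def q_def\<close>)
    then show ?thesis using C(2) by (simp add: b_def)
  qed
  \<comment> \<open>for the finitely many \<open>n\<close> outside the range of \<open>upper\<close>, the maximum makes the bound hold trivially\<close>
  define e1 where "e1 n = max 0 (real (m x n) / b n - 1)" for n
  define e2 where "e2 n = (1 + e1 n) * b n / real n ^ s - fact (k - t) / fact (r - t)" for n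
  have e1: "e1 \<longlonglongrightarrow> 0"
  proof (rule tendsto_sandwich[where f = "\<lambda>_. 0" and h = "\<lambda>n. \<bar>\<delta> (n - t)\<bar>"])
    show "(\<lambda>n. \<bar>\<delta> (n - t)\<bar>) \<longlonglongrightarrow> 0"
      using tendsto_rabs_zero[OF filterlim_compose[OF \<delta>(1) filterlim_minus_const_nat_at_top[of t]]] .
    show "\<forall>\<^sub>F n in sequentially. e1 n \<le> \<bar>\<delta> (n - t)\<bar>"
      using eventually_ge_at_top[of "(t + 1) * r"]
    proof eventually_elim
      case (elim n)
      then have "r \<le> n" by simp
      then have "real (m x n) / b n \<le> 1 + \<delta> (n - t)" using upper[OF elim] b0[of n] by (simp add: divide_le_eq)
      then show ?case by (simp add: e1_def)
    qed
  qed (simp_all add: e1_def)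
  have "(\<lambda>n. (1 + e1 n) * (real ((n - t) choose s) / real n ^ s) / real (q choose s) - fact (k - t) / fact (r - t))
      \<longlonglongrightarrow> (1 + 0) * (1 / fact s) / real (q choose s) - fact (k - t) / fact (r - t)"
    using sq by (intro tendsto_intros e1 binomial_shift_asymp) simp
  also have "(1 + 0) * (1 / fact s) / real (q choose s) - fact (k - t) / fact (r - t) = (0 :: real)"
    using binomial_fact[OF sq, where 'a = real] qs by (simp add: q_def[symmetric])
  also have "(\<lambda>n. (1 + e1 n) * (real ((n - t) choose s) / real n ^ s) / real (q choose s) - fact (k - t) / fact (r - t)) = e2"
    by (simp add: e2_def b_def fun_eq_iff)
  finally have e2: "e2 \<longlonglongrightarrow> 0" .
  have "real (m x n) \<le> (1 + e1 n) * b n \<and> (1 + e1 n) * b n = (fact (k - t) / fact (r - t) + e2 n) * real n ^ s"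
    if n: "r \<le> n" for n
  proof
    have "real (m x n) / b n \<le> 1 + e1 n" by (simp add: e1_def)
    then show "real (m x n) \<le> (1 + e1 n) * b n" using b0[OF n] by (simp add: divide_le_eq)
    have "0 < n" using n kr by simp
    then show "(1 + e1 n) * b n = (fact (k - t) / fact (r - t) + e2 n) * real n ^ s"
      by (simp add: e2_def)
  qed
  then show ?thesis using e1 e2 unfolding b_def s_def q_def by blast
qed

end
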